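(* There exist absolute constants $C>0$ and $\sigma>0$ such that the following holds. Let $n,d,M\ge 1$ be integers and let $\dot x=A(t,\varepsilon)x$ be a linear differential system of order $n$ whose coefficients (the entries of the $n\times n$ matrix $A$) are polynomials in $(t,\varepsilon)$, $\varepsilon$ one-dimensional, of degree at most $d$, with integer coefficients of modulus at most $M$. Let $[-R/2,R/2]$ be a segment on the real axis containing $[-1,1]$, let $E>0$, and fix any real $\varepsilon$ with $|\varepsilon|<E$. Let $f$ be the first component $x_1$ of a holomorphic solution of the system for this parameter value, real on the real axis and not identically zero. Then the number of zeros of $f$ on $[-R/2,R/2]$ is bounded by $$\left( (Me)^{Cn^9 d^4}\left(E^{n(n+1)d}+1\right)R^{n(n+1)d/2+1}+n\right)^{\sigma}.$$
   Context: Here $e$ is the base of natural logarithms, and "degree" means total degree in $(t,\varepsilon)$. For fixed $\varepsilon$, the system is linear with polynomial coefficients in $t$, so its solutions are entire functions of $t\in\mathbb{C}$. *)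

theory Defs
  imports Complex_Main "HOL-Computational_Algebra.Polynomial" "Jordan_Normal_Form.Matrix"
begin

text \<open>A polynomial in \<open>(t, \<epsilon>)\<close> is represented as a polynomial in \<open>t\<close> whose coefficients
  are polynomials in \<open>\<epsilon>\<close>: the coefficient of \<open>t ^ k * \<epsilon> ^ l\<close> is \<open>coeff (coeff p k) l\<close>.\<close>

definition total_degree :: "'a::zero poly poly \<Rightarrow> nat" where
  "total_degree p = Max (insert 0 {k + l | k l. coeff (coeff p k) l \<noteq> 0})"

definition eval2 :: "int poly poly \<Rightarrow> 'a::comm_ring_1 \<Rightarrow> 'a \<Rightarrow> 'a" where
  "eval2 p t \<epsilon> = poly (map_poly (\<lambda>q. poly (map_poly of_int q) \<epsilon>) p) t"

definition height_le :: "int poly poly \<Rightarrow> nat \<Rightarrow> bool" where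
  "height_le p M \<longleftrightarrow> (\<forall>k l. \<bar>coeff (coeff p k) l\<bar> \<le> int M)"

text \<open>For a fixed parameter value, the solutions of \<open>x' = A(t, \<epsilon>) x\<close> are entire in \<open>t\<close>, so they are
  taken to be defined on all of \<open>\<complex>\<close>; holomorphy is complex differentiability everywhere.\<close>

definition holomorphic_solution ::
    "nat \<Rightarrow> int poly poly mat \<Rightarrow> complex \<Rightarrow> (complex \<Rightarrow> complex vec) \<Rightarrow> bool" where
  "holomorphic_solution n A \<epsilon> x \<longleftrightarrow>
     (\<forall>t. x t \<in> carrier_vec n) \<and>
     (\<forall>i<n. \<forall>t. ((\<lambda>s. x s $ i) has_field_derivative
        ((map_mat (\<lambda>p. eval2 p t \<epsilon>) A *\<^sub>v x t) $ i)) (at t))"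

lemma finite_support2: "finite {k + l | k l. coeff (coeff (p :: 'a::zero poly poly) k) l \<noteq> 0}"
proof (rule finite_subset)
  show "{k + l | k l. coeff (coeff p k) l \<noteq> 0} \<subseteq>
      (\<Union>k\<le>degree p. (\<lambda>l. k + l) ` {..degree (coeff p k)})"
  proof
    fix m assume "m \<in> {k + l | k l. coeff (coeff p k) l \<noteq> 0}"
    then obtain k l where m: "m = k + l" and nz: "coeff (coeff p k) l \<noteq> 0" by blast
    from nz have "coeff p k \<noteq> 0" by auto
    then have "k \<le> degree p" by (rule le_degree)
    moreover have "l \<le> degree (coeff p k)" using nz by (rule le_degree)
    ultimately show "m \<in> (\<Union>k\<le>degree p. (\<lambda>l. k + l) ` {..degree (coeff p k)})"
      using m by blast
  qed
qed simp

lemma total_degree_le_iff: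
  "total_degree p \<le> d \<longleftrightarrow> (\<forall>k l. coeff (coeff p k) l \<noteq> 0 \<longrightarrow> k + l \<le> d)"
  unfolding total_degree_def using finite_support2[of p] by auto

lemma poly_map_poly_altdef:
  assumes "f 0 = (0::'a::comm_ring_1)"
  shows "poly (map_poly f p) x = (\<Sum>k\<le>degree p. f (coeff p k) * x ^ k)"
proof -
  have "degree (map_poly f p) \<le> degree p"
    by (rule degree_le) (simp add: coeff_map_poly assms coeff_eq_0)
  then have "(\<Sum>k\<le>degree (map_poly f p). coeff (map_poly f p) k * x ^ k)
      = (\<Sum>k\<le>degree p. coeff (map_poly f p) k * x ^ k)"
    by (intro sum.mono_neutral_left) (auto simp: not_le coeff_eq_0)
  then show ?thesis
    by (simp add: poly_altdef coeff_map_poly assms)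
qed

lemma eval2_altdef:
  "eval2 p t \<epsilon> = (\<Sum>k\<le>degree p. \<Sum>l\<le>degree (coeff p k).
     of_int (coeff (coeff p k) l) * \<epsilon> ^ l * t ^ k)"
  unfolding eval2_def by (simp add: poly_map_poly_altdef sum_distrib_right)

end

theory Submission
  imports Defs "Jordan_Normal_Form.Determinant" "HOL-Complex_Analysis.Complex_Analysis"
    "HOL-Library.Function_Algebras" "HOL-Computational_Algebra.Field_as_Ring"
    "HOL-Computational_Algebra.Fundamental_Theorem_Algebra"
begin

no_notation fps_nth (infixl \<open>$\<close> 75)
unbundle no vec_syntax

text \<open>
  Differentiating the first component \<open>f\<close> along the system gives \<open>f\<^sup>(\<^sup>k\<^sup>) = c\<^sub>k x\<close>, where the row \<open>c\<^sub>k\<close>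
  has entries in \<open>\<int>[t, \<epsilon>]\<close> and \<open>c\<^sub>k\<^sub>+\<^sub>1 = c\<^sub>k' + c\<^sub>k A\<close>. If \<open>r \<le> n\<close> is the first index at which the
  rows become dependent over the field of fractions, Cramer's rule yields a relation
  \<open>\<delta> c\<^sub>r = \<Sum>\<^sub>j m\<^sub>j c\<^sub>j\<close> whose coefficients are minors, so that degrees and heights are under control,
  and \<open>f\<close> solves the scalar equation \<open>\<delta> f\<^sup>(\<^sup>r\<^sup>) = \<Sum>\<^sub>j m\<^sub>j f\<^sup>(\<^sup>j\<^sup>)\<close> of order \<open>r\<close>. The obstacle is the
  parameter: near a value of \<open>\<epsilon>\<close> where every \<open>t\<close>-coefficient of \<open>\<delta>\<close> is small, the quotients
  \<open>m\<^sub>j / \<delta>\<close> might blow up, and the growth of \<open>f\<close> would escape control.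

  This does not happen, by a cyclic vector argument (\<open>cyclic_leading_coeff\<close>). The derivation
  \<open>v \<mapsto> v' + v A\<close> acts on the module generated by all the rows, and because a prime \<open>p \<in> \<real>[\<epsilon>]\<close> is
  constant in \<open>t\<close>, it also acts modulo \<open>p\<close>. A relation among \<open>c\<^sub>0, \<dots>, c\<^sub>r\<close> that loses its leading
  coefficient modulo \<open>p\<close> without vanishing there would let fewer than \<open>r\<close> rows generate everything
  modulo every power of \<open>p\<close>, up to factors prime to \<open>p\<close>, against the independence of \<open>c\<^sub>0, \<dots>, c\<^sub>r\<^sub>-\<^sub>1\<close>. Hence, once the
  common factor \<open>h(\<epsilon>)\<close> of all the coefficients is removed, the \<open>t\<close>-coefficients of \<open>\<delta>\<close> generate
  the unit ideal of \<open>\<real>[\<epsilon>]\<close>, and so before the removal the \<open>t\<close>-coefficients of every \<open>m\<^sub>j\<close> are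
  combinations of those of \<open>\<delta>\<close>. Finding these combinations amounts to a linear
  system over \<open>\<int>\<close>. Nonzero integer determinants have modulus at least 1, so the combinations have
  explicitly bounded coefficients (\<open>bounded_bezout\<close>), and this bounds the \<open>t\<close>-coefficients of the
  \<open>m\<^sub>j\<close> by a multiple of the largest \<open>t\<close>-coefficient of \<open>\<delta>\<close>, with a factor that grows
  only polynomially in \<open>\<epsilon>\<close> (\<open>uniform_scalar_equation\<close>).

  The rest is complex analysis (\<open>zero_count_linear_ode\<close>). The entire function \<open>f\<close> is followed from
  a centre \<open>c\<close> near the origin along a segment to a large circle and around that circle, on a path that
  keeps its distance from the zeros of \<open>\<delta>(\<cdot>, \<epsilon>)\<close>; along it the equation bounds the growth of
  \<open>f, \<dots>, f\<^sup>(\<^sup>r\<^sup>-\<^sup>1\<^sup>)\<close>. Cauchy's estimates bound these derivatives at \<open>c\<close> by the maximum of \<open>f\<close> on the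
  unit disc around \<open>c\<close>, so that the logarithm of the growth of \<open>f\<close> from that disc to the large
  circle is bounded; every zero on the real segment accounts for a fixed amount of it.
\<close>

section \<open>Zeros of entire solutions of a scalar equation\<close>

lemma entire_divide_zeros:
  fixes f :: "complex \<Rightarrow> complex"
  assumes "finite Z" "f holomorphic_on UNIV" "\<And>z. z \<in> Z \<Longrightarrow> f z = 0"
  shows "\<exists>g. g holomorphic_on UNIV \<and> (\<forall>t. f t = g t * (\<Prod>z\<in>Z. t - z))"
  using assms(1,3)
proof (induction Z rule: finite_induct)
  case empty
  show ?case using assms(2) by auto
next
  case (insert a Z)
  then obtain g where g: "g holomorphic_on UNIV" "\<And>t. f t = g t * (\<Prod>z\<in>Z. t - z)" by auto
  have "(\<Prod>z\<in>Z. a - z) \<noteq> 0" using insert by auto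
  then have ga: "g a = 0" using g(2)[of a] insert.prems[of a] by auto
  define h where "h = (\<lambda>z. if z = a then deriv g a else g z / (z - a) - g a / (z - a))"
  have "h holomorphic_on UNIV"
    unfolding h_def by (rule pole_theorem[OF g(1)]) auto
  moreover have "f t = h t * (\<Prod>z\<in>insert a Z. t - z)" for t
    using g(2)[of t] insert(1,2) ga by (auto simp: h_def)
  ultimately show ?case by blast
qed

text \<open>
  A form of Jensen's inequality: dividing out a zero gains a factor at least \<open>3 R\<close> on the large circle and
  loses a factor at most \<open>2 R\<close> on the unit disc. The maximum over that disc takes the place of
  the value at the centre, which may be zero.
\<close>

lemma zeros_damp_entire:
  fixes f :: "complex \<Rightarrow> complex"
  assumes f: "f holomorphic_on UNIV" and Z: "finite Z" "\<And>z. z \<in> Z \<Longrightarrow> f z = 0"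
    and ZR: "Z \<subseteq> cball c R" and R: "R \<ge> 1" and \<rho>: "\<rho> \<ge> 4 * R"
    and B: "\<And>t. t \<in> sphere c \<rho> \<Longrightarrow> cmod (f t) \<le> B" and t: "t \<in> cball c 1"
  shows "cmod (f t) \<le> (2/3) ^ card Z * B"
proof -
  obtain g where g: "g holomorphic_on UNIV" "\<And>t. f t = g t * (\<Prod>z\<in>Z. t - z)"
    using entire_divide_zeros[OF Z(1) f Z(2)] by auto
  have B0: "B \<ge> 0"
    using B[of "c + of_real \<rho>"] R \<rho> norm_ge_zero[of "f (c + of_real \<rho>)"]
    by (auto simp: dist_norm simp del: norm_ge_zero)
  have gB: "cmod (g s) \<le> B / (3 * R) ^ card Z" if s: "s \<in> sphere c \<rho>" for s
  proof -
    have "(3 * R) ^ card Z = (\<Prod>z\<in>Z. 3 * R)" by simp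
    also have "\<dots> \<le> (\<Prod>z\<in>Z. cmod (s - z))"
    proof (rule prod_mono)
      fix z assume "z \<in> Z"
      then have "dist c z \<le> R" using ZR by auto
      moreover have "dist c s \<le> dist c z + dist z s" by (rule dist_triangle)
      moreover have "dist c s = \<rho>" using s by simp
      ultimately show "0 \<le> 3 * R \<and> 3 * R \<le> cmod (s - z)"
        using R \<rho> by (simp add: dist_norm norm_minus_commute)
    qed
    finally have "cmod (g s) * (3 * R) ^ card Z \<le> cmod (g s) * (\<Prod>z\<in>Z. cmod (s - z))"
      by (intro mult_left_mono) auto
    also have "\<dots> = cmod (f s)" by (simp add: g(2)[of s] norm_mult prod_norm)
    also have "\<dots> \<le> B" using B s by simp
    finally show ?thesis using R by (simp add: field_simps)
  qed
  have "cmod (g t) \<le> B / (3 * R) ^ card Z"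
  proof (rule maximum_modulus_frontier[of g "cball c \<rho>"])
    show "g holomorphic_on interior (cball c \<rho>)" using g(1) by (rule holomorphic_on_subset) auto
    show "continuous_on (closure (cball c \<rho>)) g"
      using holomorphic_on_imp_continuous_on[OF g(1)] by (rule continuous_on_subset) auto
    show "\<And>z. z \<in> frontier (cball c \<rho>) \<Longrightarrow> cmod (g z) \<le> B / (3 * R) ^ card Z"
      using gB by (simp add: frontier_cball)
    show "t \<in> cball c \<rho>" using t R \<rho> by auto
  qed auto
  moreover have "(\<Prod>z\<in>Z. cmod (t - z)) \<le> (\<Prod>z\<in>Z. 2 * R)"
  proof (rule prod_mono)
    fix z assume "z \<in> Z"
    then have "dist c z \<le> R" using ZR by auto
    moreover have "dist t z \<le> dist t c + dist c z" by (rule dist_triangle)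
    moreover have "dist t c \<le> 1" using t by (simp add: dist_commute)
    ultimately show "0 \<le> cmod (t - z) \<and> cmod (t - z) \<le> 2 * R"
      using R by (simp add: dist_norm)
  qed
  ultimately have "cmod (g t) * (\<Prod>z\<in>Z. cmod (t - z)) \<le> B / (3 * R) ^ card Z * (2 * R) ^ card Z"
    using B0 R by (intro mult_mono) (auto intro!: prod_nonneg divide_nonneg_nonneg)
  also have "\<dots> = (2/3) ^ card Z * B"
    using R by (simp add: power_mult_distrib power_divide field_simps)
  finally show ?thesis by (simp add: g(2)[of t] norm_mult prod_norm)
qed

text \<open>
  Pigeonhole: of the \<open>D + 1\<close> points \<open>a + i / (D + 1)\<close>, two cannot be close to the same element of \<open>S\<close>.
\<close>

lemma avoid_finite_set:
  fixes S :: "real set"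
  assumes "finite S" "card S \<le> D"
  shows "\<exists>y\<in>{a..a+1}. \<forall>s\<in>S. 1 / (2 * (real D + 1)) \<le> \<bar>y - s\<bar>"
proof (rule ccontr)
  assume neg: "\<not> ?thesis"
  define y where "y i = a + real i / (real D + 1)" for i :: nat
  have "\<exists>s\<in>S. \<bar>y i - s\<bar> < 1 / (2 * (real D + 1))" if "i \<in> {..D}" for i
  proof -
    have "y i \<in> {a..a+1}" using that by (auto simp: y_def field_simps)
    then show ?thesis using neg by (auto simp: not_le)
  qed
  then obtain s where s: "\<And>i. i \<in> {..D} \<Longrightarrow> s i \<in> S \<and> \<bar>y i - s i\<bar> < 1 / (2 * (real D + 1))"
    by metis
  have "inj_on s {..D}"
  proof (rule inj_onI)
    fix i j assume ij: "i \<in> {..D}" "j \<in> {..D}" "s i = s j"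
    have "\<bar>y i - y j\<bar> < 1 / (real D + 1)"
    proof -
      have "\<bar>y i - y j\<bar> < 1 / (2 * (real D + 1)) + 1 / (2 * (real D + 1))"
        using s[OF ij(1)] s[OF ij(2)] ij(3) by linarith
      also have "\<dots> = 1 / (real D + 1)" by (simp add: field_simps)
      finally show ?thesis .
    qed
    moreover have "y i - y j = (real i - real j) / (real D + 1)"
      by (simp add: y_def diff_divide_distrib)
    ultimately have "\<bar>real i - real j\<bar> < 1" by (simp add: divide_less_cancel)
    then show "i = j" by linarith
  qed
  then have "card (s ` {..D}) = D + 1" by (simp add: card_image)
  moreover have "s ` {..D} \<subseteq> S" using s by auto
  ultimately show False using card_mono[OF assms(1), of "s ` {..D}"] assms(2) by simp
qed

text \<open>
  Splitting off a linear factor \<open>X - z\<close> costs at most \<open>1 + \<bar>z\<bar>\<close> in the size of the coefficients,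
  while the value at \<open>t\<close> changes by \<open>\<bar>t - z\<bar>\<close>; the two are comparable when \<open>t\<close> is not close to \<open>z\<close>.
\<close>

lemma coeff_le_poly_away_from_roots:
  fixes q :: "complex poly"
  assumes "degree q = D" "0 < \<eta>" "\<eta> \<le> 1" "\<And>z. poly q z = 0 \<Longrightarrow> \<eta> \<le> cmod (t - z)"
    and "cmod t \<le> T"
  shows "cmod (coeff q k) \<le> ((T + 2) / \<eta>) ^ D * cmod (poly q t)"
  using assms(1,4)
proof (induction D arbitrary: q k)
  case 0
  then obtain a where "q = [:a:]" by (metis degree_eq_zeroE)
  then show ?case by (cases k) auto
next
  case (Suc D)
  have "\<not> constant (poly q)" using Suc.prems(1) by (simp add: constant_degree)
  then obtain z where z: "poly q z = 0" using fundamental_theorem_of_algebra by blast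
  then obtain p where p: "q = [:-z, 1:] * p" by (auto simp: poly_eq_0_iff_dvd elim: dvdE)
  have p0: "p \<noteq> 0" using Suc.prems(1) p by auto
  have dp: "degree p = D" using Suc.prems(1) p0 unfolding p by (subst (asm) degree_mult_eq) auto
  have IH: "cmod (coeff p k) \<le> ((T + 2) / \<eta>) ^ D * cmod (poly p t)" for k
    using Suc.IH[OF dp] Suc.prems(2) by (simp add: p)
  let ?B = "((T + 2) / \<eta>) ^ D * cmod (poly p t)"
  have d: "\<eta> \<le> cmod (t - z)" using Suc.prems(2) z by simp
  have "cmod z \<le> cmod t + cmod (t - z)" by (metis norm_minus_commute norm_triangle_sub)
  then have "1 + cmod z \<le> (T + 1) + cmod (t - z)" using assms(5) by linarith
  also have "\<dots> \<le> (T + 1) * (cmod (t - z) / \<eta>) + cmod (t - z) / \<eta>"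
  proof (rule add_mono)
    have "1 \<le> cmod (t - z) / \<eta>" using d assms by simp
    moreover have "0 \<le> T + 1" using assms(5) norm_ge_zero[of t] by linarith
    ultimately show "T + 1 \<le> (T + 1) * (cmod (t - z) / \<eta>)"
      using mult_left_mono[of 1 "cmod (t - z) / \<eta>" "T + 1"] by simp
    show "cmod (t - z) \<le> cmod (t - z) / \<eta>"
      using assms(2,3) by (simp add: field_simps mult_left_le_one_le)
  qed
  also have "\<dots> = (T + 2) / \<eta> * cmod (t - z)"
    using assms(2) by (simp add: field_simps)
  finally have zb: "1 + cmod z \<le> (T + 2) / \<eta> * cmod (t - z)" .
  have B0: "?B \<ge> 0" using IH[of 0] norm_ge_zero order_trans by blast
  have "coeff q k = (if k = 0 then 0 else coeff p (k - 1)) - z * coeff p k"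
    by (cases k) (auto simp: p coeff_pCons)
  then have "cmod (coeff q k) \<le> cmod (if k = 0 then 0 else coeff p (k - 1)) + cmod z * cmod (coeff p k)"
    by (metis norm_mult norm_triangle_ineq4)
  also have "\<dots> \<le> ?B + cmod z * ?B"
    using IH B0 by (intro add_mono mult_left_mono) auto
  also have "\<dots> = (1 + cmod z) * ?B" by (simp add: algebra_simps)
  also have "\<dots> \<le> ((T + 2) / \<eta> * cmod (t - z)) * ?B" using zb B0 by (rule mult_right_mono)
  also have "\<dots> = ((T + 2) / \<eta>) ^ Suc D * cmod (poly q t)"
    by (simp add: p norm_mult[symmetric] mult_ac left_diff_distrib)
  finally show ?case .
qed

lemma sum_sq_le_sq_sum:
  fixes a :: "nat \<Rightarrow> real"
  assumes "\<And>j. j < r \<Longrightarrow> a j \<ge> 0"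
  shows "(\<Sum>j<r. a j) ^ 2 \<le> real r * (\<Sum>j<r. a j ^ 2)"
  using Cauchy_Schwarz_ineq_sum[of "\<lambda>_. 1" a "{..<r}"] by simp

text \<open>
  A Gronwall estimate for the vector \<open>(u\<^sub>0, \<dots>, u\<^sub>r\<^sub>-\<^sub>1)\<close> of successive derivatives. The sum of squares
  is used because it is differentiable along the path even at zeros.
\<close>

lemma growth_along_path:
  fixes u :: "nat \<Rightarrow> complex \<Rightarrow> complex"
  assumes u: "\<And>j t. j < r \<Longrightarrow> (u j has_field_derivative u (Suc j) t) (at t)"
    and \<gamma>: "\<And>s. (\<gamma> has_vector_derivative \<gamma>' s) (at s)" "\<And>s. cmod (\<gamma>' s) \<le> v"
    and K: "\<And>s. 0 \<le> s \<Longrightarrow> s \<le> L \<Longrightarrow> cmod (u r (\<gamma> s)) \<le> K * (\<Sum>j<r. cmod (u j (\<gamma> s)))"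
    and "K \<ge> 0" "0 \<le> s" "s \<le> L"
  shows "(\<Sum>j<r. (cmod (u j (\<gamma> s)))\<^sup>2)
     \<le> exp (2 * v * real r * (1 + K) * L) * (\<Sum>j<r. (cmod (u j (\<gamma> 0)))\<^sup>2)"
proof -
  define k where "k = 2 * v * real r * (1 + K)"
  have v0: "v \<ge> 0" using \<gamma>(2)[of 0] norm_ge_zero order_trans by blast
  have k0: "k \<ge> 0" unfolding k_def using v0 \<open>K \<ge> 0\<close> by auto
  define \<phi> where "\<phi> s = (\<Sum>j<r. u j (\<gamma> s) \<bullet> u j (\<gamma> s))" for s
  define d where "d j s = \<gamma>' s * u (Suc j) (\<gamma> s)" for j s
  have D1: "((\<lambda>s. u j (\<gamma> s)) has_vector_derivative d j s) (at s)" if "j < r" for j s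
    using field_vector_diff_chain_at[OF \<gamma>(1) u[OF that]] by (simp add: o_def d_def)
  have D2: "(\<phi> has_real_derivative (\<Sum>j<r. 2 * (u j (\<gamma> s) \<bullet> d j s))) (at s)" for s
  proof -
    have "((\<lambda>s. u j (\<gamma> s) \<bullet> u j (\<gamma> s)) has_real_derivative 2 * (u j (\<gamma> s) \<bullet> d j s)) (at s)"
      if "j < r" for j
      using bounded_bilinear.has_vector_derivative[OF bounded_bilinear_inner D1[OF that] D1[OF that], of s]
      by (simp add: has_real_derivative_iff_has_vector_derivative inner_commute)
    then show ?thesis unfolding \<phi>_def by (intro DERIV_sum) auto
  qed
  have \<phi>0: "\<phi> s \<ge> 0" for s unfolding \<phi>_def by (intro sum_nonneg) auto
  have bd: "(\<Sum>j<r. 2 * (u j (\<gamma> s) \<bullet> d j s)) \<le> k * \<phi> s" if s: "0 \<le> s" "s \<le> L" for s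
  proof -
    let ?S = "\<Sum>j<r. cmod (u j (\<gamma> s))"
    have S0: "?S \<ge> 0" by (intro sum_nonneg) auto
    have le: "cmod (u (Suc j) (\<gamma> s)) \<le> (1 + K) * ?S" if "j < r" for j
    proof (cases "Suc j = r")
      case True
      then have "cmod (u (Suc j) (\<gamma> s)) \<le> K * ?S" using K[OF s] by simp
      then show ?thesis using S0 by (simp add: algebra_simps)
    next
      case False
      then have "Suc j < r" using that by simp
      then have "cmod (u (Suc j) (\<gamma> s)) \<le> ?S" by (intro member_le_sum) auto
      moreover have "0 \<le> K * ?S" using S0 \<open>K \<ge> 0\<close> by simp
      ultimately show ?thesis by (simp add: algebra_simps)
    qed
    have "(\<Sum>j<r. 2 * (u j (\<gamma> s) \<bullet> d j s)) \<le> (\<Sum>j<r. 2 * (cmod (u j (\<gamma> s)) * (v * ((1 + K) * ?S))))"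
    proof (intro sum_mono mult_left_mono)
      fix j assume j: "j \<in> {..<r}"
      have "u j (\<gamma> s) \<bullet> d j s \<le> cmod (u j (\<gamma> s)) * cmod (d j s)" by (rule norm_cauchy_schwarz)
      also have "cmod (d j s) \<le> v * ((1 + K) * ?S)"
        unfolding d_def norm_mult using \<gamma>(2) le[of j] j v0 by (intro mult_mono) auto
      finally show "u j (\<gamma> s) \<bullet> d j s \<le> cmod (u j (\<gamma> s)) * (v * ((1 + K) * ?S))"
        by (simp add: mult_left_mono)
    qed simp
    also have "\<dots> = 2 * v * (1 + K) * ?S ^ 2"
      unfolding power2_eq_square
      by (subst sum_distrib_left[symmetric], subst sum_distrib_right[symmetric]) (simp add: mult_ac)
    also have "\<dots> \<le> 2 * v * (1 + K) * (real r * (\<Sum>j<r. cmod (u j (\<gamma> s)) ^ 2))"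
      using v0 \<open>K \<ge> 0\<close> by (intro mult_left_mono sum_sq_le_sq_sum) auto
    also have "\<dots> = k * \<phi> s" by (simp add: k_def \<phi>_def power2_norm_eq_inner)
    finally show ?thesis .
  qed
  define \<psi> where "\<psi> s = exp (- k * s) * \<phi> s" for s
  have "\<psi> s \<le> \<psi> 0"
  proof (rule DERIV_nonpos_imp_nonincreasing[OF \<open>0 \<le> s\<close>])
    fix x assume x: "0 \<le> x" "x \<le> s"
    have "(\<psi> has_real_derivative
        (exp (- k * x) * (- k) * \<phi> x + exp (- k * x) * (\<Sum>j<r. 2 * (u j (\<gamma> x) \<bullet> d j x)))) (at x)"
      unfolding \<psi>_def by (rule derivative_eq_intros refl D2 | simp)+
    moreover have "exp (- k * x) * (- k) * \<phi> x + exp (- k * x) * (\<Sum>j<r. 2 * (u j (\<gamma> x) \<bullet> d j x)) \<le> 0"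
      using mult_left_mono[OF bd[of x], of "exp (- k * x)"] x \<open>s \<le> L\<close> by (simp add: algebra_simps)
    ultimately show "\<exists>y. (\<psi> has_real_derivative y) (at x) \<and> y \<le> 0" by blast
  qed
  then have "exp (- k * s) * \<phi> s \<le> \<phi> 0" by (simp add: \<psi>_def)
  then have "\<phi> s \<le> exp (k * s) * \<phi> 0"
    by (simp add: exp_minus field_simps)
  also have "\<dots> \<le> exp (k * L) * \<phi> 0"
    using k0 \<phi>0[of 0] \<open>s \<le> L\<close> by (intro mult_right_mono) (auto intro: mult_left_mono)
  finally show ?thesis by (simp add: \<phi>_def k_def power2_norm_eq_inner)
qed

text \<open>
  The equation enters only along a path that avoids the zeros of the leading coefficient \<open>q\<close>, where it
  is bounded below by a fixed multiple of its largest coefficient. As \<open>f\<close> is entire, the maximum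
  principle carries the bound from the circle to its interior, where \<open>q\<close> may vanish.
\<close>

lemma zero_count_linear_ode:
  fixes f :: "complex \<Rightarrow> complex" and q :: "complex poly" and p :: "nat \<Rightarrow> complex poly"
  assumes f: "f holomorphic_on UNIV" and nz: "f w \<noteq> 0"
    and R: "R \<ge> 2" and \<Lambda>: "\<Lambda> \<ge> 0" and r: "r \<ge> 1"
    and q: "q \<noteq> 0" "degree q \<le> D" and p: "\<And>j. j < r \<Longrightarrow> degree (p j) \<le> D"
    and ode: "\<And>t. poly q t * (deriv ^^ r) f t = (\<Sum>j<r. poly (p j) t * (deriv ^^ j) f t)"
    and bnd: "\<And>j k. j < r \<Longrightarrow> \<exists>i. cmod (coeff (p j) k) \<le> \<Lambda> * cmod (coeff q i)"
    and Z: "finite Z" "\<And>z. z \<in> Z \<Longrightarrow> f z = 0" "Z \<subseteq> complex_of_real ` {-R/2..R/2}"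
  shows "real (card Z) \<le> 3 * (40 * R * real r * (1 + (real D + 1) * \<Lambda> * (60 * (real D + 1) * R\<^sup>2) ^ D)
            + ln (real r * fact r))"
proof -
  define \<eta> where "\<eta> = 1 / (2 * (real D + 1))"
  have \<eta>: "0 < \<eta>" "\<eta> \<le> 1" by (auto simp: \<eta>_def field_simps)
  define K where "K = (real D + 1) * \<Lambda> * (60 * (real D + 1) * R\<^sup>2) ^ D"
  have K0: "K \<ge> 0" using \<Lambda> unfolding K_def by auto
  define S where "S = {z. poly q z = 0}"
  have S: "finite S" "card S \<le> D"
    using poly_roots_finite[OF q(1)] card_poly_roots_bound[OF q(1)] q(2) unfolding S_def by auto
  \<comment> \<open>height of a horizontal line and radius of a circle that avoid the zeros of \<open>q\<close>\<close>
  obtain y where y: "0 \<le> y" "y \<le> 1" "\<And>z. z \<in> S \<Longrightarrow> \<eta> \<le> \<bar>y - Im z\<bar>"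
    using avoid_finite_set[of "Im ` S" D 0] S card_image_le[OF S(1), of Im] by (auto simp: \<eta>_def)
  define c where "c = \<i> * complex_of_real y"
  have cn: "cmod c \<le> 1" using y by (simp add: c_def norm_mult)
  obtain \<rho> where \<rho>: "4 * R \<le> \<rho>" "\<rho> \<le> 4 * R + 1" "\<And>z. z \<in> S \<Longrightarrow> \<eta> \<le> \<bar>\<rho> - cmod (z - c)\<bar>"
    using avoid_finite_set[of "(\<lambda>z. cmod (z - c)) ` S" D "4 * R"] S
      card_image_le[OF S(1), of "\<lambda>z. cmod (z - c)"] by (auto simp: \<eta>_def)
  have \<rho>5: "\<rho> \<le> 5 * R" "0 \<le> \<rho>" using \<rho> R by auto
  define u where "u j = (deriv ^^ j) f" for j
  have uder: "(u j has_field_derivative u (Suc j) t) (at t)" for j t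
    unfolding u_def using holomorphic_higher_deriv[OF f open_UNIV, of j]
    by (auto intro!: holomorphic_derivI)
  have Kb: "cmod (u r t) \<le> K * (\<Sum>j<r. cmod (u j t))"
    if t: "cmod t \<le> 5 * R" "\<And>z. z \<in> S \<Longrightarrow> \<eta> \<le> cmod (t - z)" for t
  proof -
    define W where "W = ((6 * R) / \<eta>) ^ D"
    have W0: "W \<ge> 0" using R \<eta> by (simp add: W_def)
    have cq: "cmod (coeff q i) \<le> W * cmod (poly q t)" for i
    proof -
      have "cmod (coeff q i) \<le> ((5 * R + 2) / \<eta>) ^ degree q * cmod (poly q t)"
        by (rule coeff_le_poly_away_from_roots) (use t \<eta> in \<open>auto simp: S_def\<close>)
      also have "((5 * R + 2) / \<eta>) ^ degree q \<le> ((6 * R) / \<eta>) ^ degree q"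
        using R \<eta> by (intro power_mono divide_right_mono) auto
      also have "\<dots> \<le> W"
        unfolding W_def using q(2)
      proof (rule power_increasing)
        show "1 \<le> 6 * R / \<eta>" using R \<eta> by (simp add: field_simps)
      qed
      finally show ?thesis by (simp add: mult_right_mono)
    qed
    have pj: "cmod (poly (p j) t) \<le> (real D + 1) * \<Lambda> * W * (5 * R) ^ D * cmod (poly q t)" if j: "j < r" for j
    proof -
      have ck: "cmod (coeff (p j) k) \<le> \<Lambda> * (W * cmod (poly q t))" for k
      proof -
        obtain i where "cmod (coeff (p j) k) \<le> \<Lambda> * cmod (coeff q i)" using bnd[OF j] by blast
        also have "\<dots> \<le> \<Lambda> * (W * cmod (poly q t))" using cq \<Lambda> by (intro mult_left_mono) auto
        finally show ?thesis .
      qed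
      have "poly (p j) t = (\<Sum>k\<le>D. coeff (p j) k * t ^ k)"
        unfolding poly_altdef using p[OF j]
        by (intro sum.mono_neutral_left) (auto simp: not_le coeff_eq_0)
      then have "cmod (poly (p j) t) \<le> (\<Sum>k\<le>D. cmod (coeff (p j) k) * cmod t ^ k)"
        by (simp add: norm_mult norm_power sum_norm_le)
      also have "\<dots> \<le> (\<Sum>k\<le>D. (\<Lambda> * (W * cmod (poly q t))) * (5 * R) ^ D)"
      proof (rule sum_mono)
        fix k assume k: "k \<in> {..D}"
        have "cmod t ^ k \<le> (5 * R) ^ k" using t(1) by (intro power_mono) auto
        also have "\<dots> \<le> (5 * R) ^ D" using k R by (intro power_increasing) auto
        finally show "cmod (coeff (p j) k) * cmod t ^ k \<le> (\<Lambda> * (W * cmod (poly q t))) * (5 * R) ^ D"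
          using ck \<Lambda> W0 by (intro mult_mono) auto
      qed
      also have "\<dots> = (real D + 1) * \<Lambda> * W * (5 * R) ^ D * cmod (poly q t)" by (simp add: mult_ac)
      finally show ?thesis .
    qed
    have qt: "cmod (poly q t) > 0"
      using t(2)[of t] \<eta>(1) by (auto simp: S_def)
    have WK: "(real D + 1) * \<Lambda> * W * (5 * R) ^ D = K"
    proof -
      have "(6 * R) / \<eta> * (5 * R) = 60 * (real D + 1) * R\<^sup>2"
        by (simp add: \<eta>_def power2_eq_square)
      then have "W * (5 * R) ^ D = (60 * (real D + 1) * R\<^sup>2) ^ D"
        unfolding W_def by (simp only: power_mult_distrib[symmetric])
      then show ?thesis by (simp add: K_def mult.assoc)
    qed
    have "cmod (poly q t) * cmod (u r t) = cmod (\<Sum>j<r. poly (p j) t * u j t)"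
      using ode[of t] by (simp add: u_def norm_mult[symmetric])
    also have "\<dots> \<le> (\<Sum>j<r. cmod (poly (p j) t) * cmod (u j t))"
      by (simp add: norm_mult sum_norm_le)
    also have "\<dots> \<le> (\<Sum>j<r. (K * cmod (poly q t)) * cmod (u j t))"
      using pj unfolding WK by (intro sum_mono mult_right_mono) auto
    also have "\<dots> = cmod (poly q t) * (K * (\<Sum>j<r. cmod (u j t)))"
      by (simp add: sum_distrib_left mult_ac)
    finally show ?thesis using qt by simp
  qed
  define k where "k = 2 * real r * (1 + K)"
  have k0: "k \<ge> 0" using K0 by (simp add: k_def)
  define \<phi> where "\<phi> t = (\<Sum>j<r. (cmod (u j t))\<^sup>2)" for t
  have \<phi>0: "\<phi> t \<ge> 0" for t by (simp add: \<phi>_def sum_nonneg)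
  have seg: "\<phi> (c + of_real \<rho>) \<le> exp (k * \<rho>) * \<phi> c"
  proof -
    let ?\<gamma> = "\<lambda>s. c + complex_of_real s"
    have "(\<Sum>j<r. (cmod (u j (?\<gamma> \<rho>)))\<^sup>2)
       \<le> exp (2 * 1 * real r * (1 + K) * \<rho>) * (\<Sum>j<r. (cmod (u j (?\<gamma> 0)))\<^sup>2)"
    proof (rule growth_along_path[where \<gamma>' = "\<lambda>_. 1"])
      show "(?\<gamma> has_vector_derivative 1) (at s)" for s
        by (auto intro!: derivative_eq_intros simp: has_vector_derivative_def scaleR_conv_of_real)
      fix s assume s: "0 \<le> s" "s \<le> \<rho>"
      show "cmod (u r (?\<gamma> s)) \<le> K * (\<Sum>j<r. cmod (u j (?\<gamma> s)))"
      proof (rule Kb)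
        have "cmod (?\<gamma> s) \<le> 1 + s" using cn s norm_triangle_ineq[of c "of_real s"] by simp
        then show "cmod (?\<gamma> s) \<le> 5 * R" using s \<rho> R by linarith
        fix z assume "z \<in> S"
        then have "\<eta> \<le> \<bar>Im (?\<gamma> s - z)\<bar>" using y(3) by (simp add: c_def)
        also have "\<dots> \<le> cmod (?\<gamma> s - z)" by (rule abs_Im_le_cmod)
        finally show "\<eta> \<le> cmod (?\<gamma> s - z)" .
      qed
    qed (use uder K0 \<rho>5 in auto)
    then show ?thesis by (simp add: \<phi>_def k_def)
  qed
  have circ: "\<phi> t \<le> exp (k * \<rho> * (2 * pi)) * \<phi> (c + of_real \<rho>)" if t: "t \<in> sphere c \<rho>" for t
  proof -
    let ?\<gamma> = "\<lambda>s. c + of_real \<rho> * exp (\<i> * complex_of_real s)"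
    define a where "a = Arg2pi (t - c)"
    have a: "0 \<le> a" "a \<le> 2 * pi" using Arg2pi[of "t - c"] by (auto simp: a_def)
    have ta: "t = ?\<gamma> a"
      using Arg2pi_eq[of "t - c"] t by (simp add: a_def dist_norm norm_minus_commute)
    have "(\<Sum>j<r. (cmod (u j (?\<gamma> a)))\<^sup>2)
       \<le> exp (2 * \<rho> * real r * (1 + K) * (2 * pi)) * (\<Sum>j<r. (cmod (u j (?\<gamma> 0)))\<^sup>2)"
    proof (rule growth_along_path[where \<gamma>' = "\<lambda>s. of_real \<rho> * (\<i> * exp (\<i> * complex_of_real s))"])
      fix s :: real
      have "((\<lambda>s. exp (\<i> * complex_of_real s)) has_vector_derivative (\<i> * exp (\<i> * complex_of_real s))) (at s)"
        by (rule has_vector_derivative_real_field) (auto intro!: derivative_eq_intros)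
      then show "(?\<gamma> has_vector_derivative of_real \<rho> * (\<i> * exp (\<i> * complex_of_real s))) (at s)"
        by (auto intro!: derivative_eq_intros)
      show "cmod (of_real \<rho> * (\<i> * exp (\<i> * complex_of_real s))) \<le> \<rho>"
        using \<rho>5 by (simp add: norm_mult)
    next
      fix s :: real
      show "cmod (u r (?\<gamma> s)) \<le> K * (\<Sum>j<r. cmod (u j (?\<gamma> s)))"
      proof (rule Kb)
        have nc: "cmod (?\<gamma> s - c) = \<rho>" using \<rho>5 by (simp add: norm_mult)
        then have "cmod (?\<gamma> s) \<le> 1 + \<rho>" using cn norm_triangle_ineq[of c "?\<gamma> s - c"] by simp
        then show "cmod (?\<gamma> s) \<le> 5 * R" using \<rho> R by linarith
        fix z assume "z \<in> S"
        then have "\<eta> \<le> \<bar>\<rho> - cmod (z - c)\<bar>" using \<rho>(3) by blast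
        also have "\<dots> \<le> cmod (?\<gamma> s - z)"
          using norm_triangle_ineq3[of "?\<gamma> s - c" "z - c"] nc by (simp add: diff_diff_eq2 add.commute)
        finally show "\<eta> \<le> cmod (?\<gamma> s - z)" .
      qed
    qed (use uder K0 \<rho>5 a in auto)
    then show ?thesis by (simp add: \<phi>_def k_def ta[symmetric] mult_ac)
  qed
  define B where "B = exp (40 * R * real r * (1 + K))"
  have big: "\<phi> t \<le> B\<^sup>2 * \<phi> c" if t: "t \<in> sphere c \<rho>" for t
  proof -
    have "\<phi> t \<le> exp (k * \<rho> * (2 * pi)) * (exp (k * \<rho>) * \<phi> c)"
      using circ[OF t] seg by (meson exp_ge_zero mult_left_mono order_trans)
    also have "\<dots> = exp (k * (\<rho> * (2 * pi + 1))) * \<phi> c"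
      by (simp add: exp_add[symmetric] algebra_simps)
    also have "\<dots> \<le> exp (k * (40 * R)) * \<phi> c"
    proof (intro mult_right_mono \<phi>0)
      have "\<rho> * (2 * pi + 1) \<le> (5 * R) * 8"
        using \<rho>5 pi_less_4 pi_approx by (intro mult_mono) auto
      then show "exp (k * (\<rho> * (2 * pi + 1))) \<le> exp (k * (40 * R))"
        using k0 by (auto intro!: mult_left_mono)
    qed
    also have "exp (k * (40 * R)) = B\<^sup>2"
      by (simp add: B_def k_def exp_double[symmetric] mult_ac)
    finally show ?thesis .
  qed
  have "continuous_on (cball c 1) (\<lambda>t. cmod (f t))"
    by (rule continuous_on_norm, rule continuous_on_subset[OF holomorphic_on_imp_continuous_on[OF f]]) auto
  then obtain m where m: "m \<in> cball c 1" "\<And>t. t \<in> cball c 1 \<Longrightarrow> cmod (f t) \<le> cmod (f m)"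
    using continuous_attains_sup[of "cball c 1" "\<lambda>t. cmod (f t)"] by auto
  define s where "s = cmod (f m)"
  have s0: "s > 0"
  proof (rule ccontr)
    assume "\<not> s > 0"
    then have z: "f t = 0" if "t \<in> cball c 1" for t using m(2)[OF that] by (simp add: s_def)
    have "f w = 0"
    proof (rule analytic_continuation_open[of "ball c 1" UNIV f "\<lambda>_. 0"])
      show "f holomorphic_on UNIV" by (rule f)
    qed (use z in auto)
    then show False using nz by simp
  qed
  have uc: "cmod (u j c) \<le> fact r * s" if j: "j < r" for j
  proof -
    have "cmod ((deriv ^^ j) f c) \<le> fact j * s / 1 ^ j"
    proof (rule Cauchy_inequality)
      show "f holomorphic_on ball c 1" using f by (rule holomorphic_on_subset) auto
      show "continuous_on (cball c 1) f"
        using holomorphic_on_imp_continuous_on[OF f] by (rule continuous_on_subset) auto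
      show "\<And>x. cmod (c - x) = 1 \<Longrightarrow> cmod (f x) \<le> s" using m(2) by (auto simp: s_def dist_norm)
    qed simp
    also have "\<dots> \<le> fact r * s" using j s0 by (simp add: fact_mono mult_right_mono)
    finally show ?thesis by (simp add: u_def)
  qed
  have \<phi>c: "\<phi> c \<le> (real r * fact r * s)\<^sup>2"
  proof -
    have "\<phi> c \<le> (\<Sum>j<r. (fact r * s)\<^sup>2)"
      unfolding \<phi>_def using uc by (intro sum_mono power_mono) auto
    also have "\<dots> = real r * (fact r * s)\<^sup>2" by simp
    also have "\<dots> \<le> (real r)\<^sup>2 * (fact r * s)\<^sup>2"
      using r by (intro mult_right_mono) (auto simp: power2_eq_square)
    finally show ?thesis by (simp add: power_mult_distrib mult_ac)
  qed
  have fb: "cmod (f t) \<le> B * (real r * fact r * s)" if t: "t \<in> sphere c \<rho>" for t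
  proof (rule power2_le_imp_le)
    have "(cmod (f t))\<^sup>2 = (cmod (u 0 t))\<^sup>2" by (simp add: u_def)
    also have "\<dots> \<le> \<phi> t" unfolding \<phi>_def using r by (intro member_le_sum) auto
    also have "\<dots> \<le> B\<^sup>2 * \<phi> c" by (rule big[OF t])
    also have "\<dots> \<le> B\<^sup>2 * (real r * fact r * s)\<^sup>2" using \<phi>c by (intro mult_left_mono) auto
    finally show "(cmod (f t))\<^sup>2 \<le> (B * (real r * fact r * s))\<^sup>2" by (simp add: power_mult_distrib)
    show "0 \<le> B * (real r * fact r * s)" using s0 by (simp add: B_def)
  qed
  have "s \<le> (2/3) ^ card Z * (B * (real r * fact r * s))"
    unfolding s_def
  proof (rule zeros_damp_entire[OF f Z(1,2) _ _ \<rho>(1) _ m(1)])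
    show "Z \<subseteq> cball c R"
    proof
      fix z assume "z \<in> Z"
      then obtain x where x: "z = complex_of_real x" "\<bar>x\<bar> \<le> R / 2" using Z(3) by force
      have "dist c z \<le> cmod c + cmod z" by (simp add: dist_norm norm_triangle_ineq4)
      then show "z \<in> cball c R" using x cn R by simp
    qed
  qed (use fb R in \<open>auto simp: s_def\<close>)
  then have "s * (3/2) ^ card Z \<le> s * (B * (real r * fact r))"
    by (simp add: field_simps)
  then have "(3/2) ^ card Z \<le> B * (real r * fact r)" using s0 by simp
  then have "ln ((3/2) ^ card Z) \<le> ln (B * (real r * fact r))"
    by (subst ln_le_cancel_iff) (use r in \<open>auto simp: B_def\<close>)
  then have "real (card Z) * ln (3/2) \<le> 40 * R * real r * (1 + K) + ln (real r * fact r)"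
    using r by (simp add: B_def ln_mult ln_realpow)
  moreover have "real (card Z) * (1/3) \<le> real (card Z) * ln (3/2)"
  proof (rule mult_left_mono)
    have "ln (2/3 :: real) \<le> 2/3 - 1" by (rule ln_le_minus_one) simp
    then show "1/3 \<le> ln (3/2 :: real)" using ln_inverse[of "2/3 :: real"] by simp
  qed simp
  ultimately show ?thesis by (simp add: K_def)
qed

section \<open>The rows that express the derivatives of the first component\<close>

text \<open>
  If \<open>x' = A x\<close> then \<open>(v x)' = (v' + v A) x\<close> for a row \<open>v\<close>. Rows are functions on \<open>\<nat>\<close>, so that
  they form a module whatever the order \<open>n\<close> of the system is.
\<close>

definition dual_deriv :: "nat \<Rightarrow> (nat \<Rightarrow> nat \<Rightarrow> 'a::idom poly) \<Rightarrow> (nat \<Rightarrow> 'a poly) \<Rightarrow> nat \<Rightarrow> 'a poly" where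
  "dual_deriv n A v q = pderiv (v q) + (\<Sum>p<n. v p * A p q)"

text \<open>
  The \<open>k\<close>-th derivative of the first component of a solution \<open>x\<close> is \<open>jet_row n A k\<close> times \<open>x\<close>.
\<close>

definition jet_row :: "nat \<Rightarrow> (nat \<Rightarrow> nat \<Rightarrow> 'a::idom poly) \<Rightarrow> nat \<Rightarrow> nat \<Rightarrow> 'a poly" where
  "jet_row n A k = (dual_deriv n A ^^ k) (\<lambda>q. if q = 0 then 1 else 0)"

lemma jet_row_0: "jet_row n A 0 q = (if q = 0 then 1 else 0)"
  by (simp add: jet_row_def)

lemma jet_row_Suc: "jet_row n A (Suc k) = dual_deriv n A (jet_row n A k)"
  by (simp add: jet_row_def)

lemma dual_deriv_add: "dual_deriv n A (\<lambda>q. v q + w q) = (\<lambda>q. dual_deriv n A v q + dual_deriv n A w q)"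
  by (auto simp: dual_deriv_def pderiv_add algebra_simps sum.distrib)

lemma dual_deriv_scale:
  "dual_deriv n A (\<lambda>q. a * v q) = (\<lambda>q. pderiv a * v q + a * dual_deriv n A v q)"
  by (auto simp: dual_deriv_def pderiv_mult algebra_simps sum_distrib_left)

interpretation covec: Modules.module "\<lambda>(a :: 'a :: comm_ring_1 poly) (v :: nat \<Rightarrow> 'a poly) q. a * v q"
  by unfold_locales (auto simp: algebra_simps)

lemma dual_deriv_zero: "dual_deriv n A 0 = 0"
  by (auto simp: dual_deriv_def)

lemma sum_fun_apply: "(\<Sum>j\<in>J. (f j :: 'a \<Rightarrow> 'b :: comm_monoid_add)) x = (\<Sum>j\<in>J. f j x)"
  by (induction J rule: infinite_finite_induct) auto

lemma dual_deriv_span: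
  assumes "v \<in> covec.span V" "\<And>c. c \<in> V \<Longrightarrow> dual_deriv n A c \<in> covec.span W" "V \<subseteq> covec.span W"
  shows "dual_deriv n A v \<in> covec.span W \<and> v \<in> covec.span W"
  using assms(1)
proof (induction rule: covec.span_induct_alt)
  case base
  show ?case unfolding dual_deriv_zero by (intro conjI covec.span_zero)
next
  case (step a c v)
  have "dual_deriv n A ((\<lambda>q. a * c q) + v)
      = (\<lambda>q. pderiv a * c q) + (\<lambda>q. a * dual_deriv n A c q) + dual_deriv n A v"
    using dual_deriv_add[of n A "\<lambda>q. a * c q" v] dual_deriv_scale[of n A a c]
    by (auto simp: plus_fun_def)
  moreover have "(\<lambda>q. pderiv a * c q) + (\<lambda>q. a * dual_deriv n A c q) + dual_deriv n A v \<in> covec.span W"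
    using step assms(2)[of c] assms(3) by (intro covec.span_add covec.span_scale) auto
  moreover have "(\<lambda>q. a * c q) + v \<in> covec.span W"
    using step assms(3) by (intro covec.span_add covec.span_scale) auto
  ultimately show ?case by (metis (no_types, lifting))
qed

lemma covec_functional_span:
  fixes Y :: "nat \<Rightarrow> 'a::idom poly"
  assumes "v \<in> covec.span V" "\<And>c. c \<in> V \<Longrightarrow> (\<Sum>j<r. Y j * c (\<phi> j)) = 0"
  shows "(\<Sum>j<r. Y j * v (\<phi> j)) = 0"
  using assms(1)
proof (induction rule: covec.span_induct_alt)
  case (step a c v)
  have "(\<Sum>j<r. Y j * (a * c (\<phi> j) + v (\<phi> j)))
      = a * (\<Sum>j<r. Y j * c (\<phi> j)) + (\<Sum>j<r. Y j * v (\<phi> j))"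
    by (simp add: algebra_simps sum.distrib sum_distrib_left)
  then show ?case using step assms(2) by simp
qed simp

text \<open>
  The derivation \<open>dual_deriv\<close> preserves the module \<open>N\<close> spanned by all rows and, as \<open>p\<close> does not
  depend on the variable of differentiation, also \<open>p N\<close>. If \<open>m\<^sub>\<sigma>\<close> is the last coefficient not divisible
  by \<open>p\<close>, the relation puts row \<open>\<sigma>\<close> into the span \<open>L\<close> of the earlier rows modulo \<open>p N\<close>, up to a
  multiplier prime to \<open>p\<close>; differentiation propagates this to all later rows, so that
  \<open>N = L + p N\<close> and by iteration \<open>N = L + p\<^sup>i N\<close> for every \<open>i\<close>, always up to such multipliers. The
  functional dual to row \<open>\<sigma>\<close> kills \<open>L\<close>, hence its value \<open>\<Delta>\<close> on that row is divisible by every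
  power of \<open>p\<close>.

  The multipliers stand in for the localization at \<open>p\<close>, and the functionals \<open>Y k\<close> with
  their common denominator \<open>\<Delta>\<close> express the independence of the first \<open>r\<close> rows.
\<close>

lemma cyclic_leading_coeff:
  fixes p :: "'a :: {factorial_ring_gcd, semiring_gcd_mult_normalize}" and A :: "nat \<Rightarrow> nat \<Rightarrow> 'a poly"
  assumes p: "prime_elem p"
    and rel: "\<And>q. \<delta> * jet_row n A r q = (\<Sum>j<r. m j * jet_row n A j q)"
    and \<delta>: "[:p:] dvd \<delta>" and s: "s < r" "\<not> [:p:] dvd m s"
    and dual: "\<And>i k. i < r \<Longrightarrow> k < r \<Longrightarrow>
        (\<Sum>j<r. Y k j * jet_row n A i (\<phi> j)) = (if i = k then \<Delta> else 0)"
    and \<Delta>: "\<Delta> \<noteq> 0"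
  shows False
proof -
  let ?c = "jet_row n A"
  let ?D = "dual_deriv n A"
  define \<pi> where "\<pi> = [:p:]"
  have \<pi>: "prime_elem \<pi>" unfolding \<pi>_def using p by (rule lift_prime_elem_poly)
  have \<pi>0: "pderiv \<pi> = 0" by (simp add: \<pi>_def pderiv_pCons)
  define \<sigma> where "\<sigma> = Max {j. j < r \<and> \<not> \<pi> dvd m j}"
  have fin: "finite {j. j < r \<and> \<not> \<pi> dvd m j}" by simp
  have \<sigma>: "\<sigma> < r" "\<not> \<pi> dvd m \<sigma>"
  proof -
    have "{j. j < r \<and> \<not> \<pi> dvd m j} \<noteq> {}" using s unfolding \<pi>_def by blast
    from Max_in[OF fin this] show "\<sigma> < r" "\<not> \<pi> dvd m \<sigma>" unfolding \<sigma>_def by auto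
  qed
  have above: "\<pi> dvd m j" if "\<sigma> < j" "j < r" for j
    using Max_ge[OF fin, of j] that unfolding \<sigma>_def by fastforce
  define N where "N = covec.span (range ?c)"
  define L where "L = covec.span (?c ` {..<\<sigma>})"
  have cN: "?c j \<in> N" for j unfolding N_def by (intro covec.span_base) auto
  have DN: "?D v \<in> N" if "v \<in> N" for v
    using dual_deriv_span[of v "range ?c" n A "range ?c"] that cN jet_row_Suc[of n A, symmetric]
    unfolding N_def by (auto intro: covec.span_base)
  note Nadd = covec.span_add[of _ "range ?c", folded N_def]
  note Nscale = covec.span_scale[of _ "range ?c", folded N_def]
  note Ladd = covec.span_add[of _ "?c ` {..<\<sigma>}", folded L_def]
  note Lscale = covec.span_scale[of _ "?c ` {..<\<sigma>}", folded L_def]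
  \<comment> \<open>\<open>E i v\<close>: a multiple of \<open>v\<close> by a factor prime to \<open>\<pi>\<close> lies in \<open>L + \<pi> ^ i N\<close>\<close>
  define E where "E i v \<longleftrightarrow> (\<exists>a l w. \<not> \<pi> dvd a \<and> l \<in> L \<and> w \<in> N \<and> (\<forall>q. a * v q = l q + \<pi> ^ i * w q))" for i v
  have EI: "E i v" if "\<not> \<pi> dvd a" "l \<in> L" "w \<in> N" "\<And>q. a * v q = l q + \<pi> ^ i * w q" for i a l w v
    unfolding E_def using that by blast
  have Eadd: "E 1 (\<lambda>q. v q + w q)" if "E 1 v" "E 1 w" for v w
  proof -
    from that obtain a l x a' l' x' where h: "\<not> \<pi> dvd a" "l \<in> L" "x \<in> N" "\<And>q. a * v q = l q + \<pi> ^ 1 * x q"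
      "\<not> \<pi> dvd a'" "l' \<in> L" "x' \<in> N" "\<And>q. a' * w q = l' q + \<pi> ^ 1 * x' q" unfolding E_def by metis
    show ?thesis
    proof (rule EI)
      show "\<not> \<pi> dvd a * a'" using h \<pi> by (simp add: prime_elem_dvd_mult_iff)
      show "(\<lambda>q. a' * l q) + (\<lambda>q. a * l' q) \<in> L" using h by (intro Ladd Lscale)
      show "(\<lambda>q. a' * x q) + (\<lambda>q. a * x' q) \<in> N" using h by (intro Nadd Nscale)
      fix q
      have "a * a' * (v q + w q) = a' * (a * v q) + a * (a' * w q)" by (simp add: algebra_simps)
      then show "a * a' * (v q + w q) = ((\<lambda>q. a' * l q) + (\<lambda>q. a * l' q)) q
          + \<pi> ^ 1 * ((\<lambda>q. a' * x q) + (\<lambda>q. a * x' q)) q"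
        unfolding h(4,8) by (simp add: algebra_simps)
    qed
  qed
  have Escale: "E 1 (\<lambda>q. b * v q)" if "E 1 v" for b v
  proof -
    from that obtain a l x where h: "\<not> \<pi> dvd a" "l \<in> L" "x \<in> N" "\<And>q. a * v q = l q + \<pi> ^ 1 * x q"
      unfolding E_def by metis
    show ?thesis
    proof (rule EI)
      show "\<not> \<pi> dvd a" by fact
      show "(\<lambda>q. b * l q) \<in> L" "(\<lambda>q. b * x q) \<in> N" using h Lscale Nscale by auto
      fix q
      have "a * (b * v q) = b * (a * v q)" by (simp add: algebra_simps)
      then show "a * (b * v q) = b * l q + \<pi> ^ 1 * (b * x q)" unfolding h(4) by (simp add: algebra_simps)
    qed
  qed
  have Ecancel: "E 1 v" if "\<not> \<pi> dvd b" "E 1 (\<lambda>q. b * v q)" for b v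
  proof -
    from that obtain a l x where h: "\<not> \<pi> dvd a" "l \<in> L" "x \<in> N" "\<And>q. a * (b * v q) = l q + \<pi> ^ 1 * x q"
      unfolding E_def by metis
    show ?thesis
      by (rule EI[of "a * b" l x]) (use h that \<pi> in \<open>auto simp: prime_elem_dvd_mult_iff mult.assoc\<close>)
  qed
  have \<pi>1: "\<not> \<pi> dvd 1" using \<pi> prime_elem_not_unit by blast
  have E\<pi>: "E 1 (\<lambda>q. \<pi> * w q)" if "w \<in> N" for w
    by (rule EI[of 1 "\<lambda>q. 0" w]) (use that \<pi>1 covec.span_zero in \<open>auto simp: L_def zero_fun_def\<close>)
  have EL: "E 1 l" if "l \<in> L" for l
    by (rule EI[of 1 l "\<lambda>q. 0"]) (use that \<pi>1 covec.span_zero in \<open>auto simp: N_def zero_fun_def\<close>)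
  have Ec0: "E 1 (?c j)" if "j < \<sigma>" for j
    using that by (intro EL) (auto simp: L_def intro: covec.span_base)
  have E\<sigma>: "E 1 (?c \<sigma>)"
  proof -
    obtain \<delta>' where \<delta>': "\<delta> = \<pi> * \<delta>'" using \<delta> by (auto simp: \<pi>_def)
    define m' where "m' j = (if \<sigma> < j \<and> j < r then (SOME x. m j = \<pi> * x) else 0)" for j
    have m': "m j = \<pi> * m' j" if "\<sigma> < j" "j < r" for j
      using someI_ex[of "\<lambda>x. m j = \<pi> * x"] above[OF that] that unfolding m'_def by (auto elim: dvdE)
    show ?thesis
    proof (rule EI)
      show "\<not> \<pi> dvd m \<sigma>" by fact
      show "(\<Sum>j<\<sigma>. (\<lambda>q. (- m j) * ?c j q)) \<in> L"
        unfolding L_def by (intro covec.span_sum covec.span_scale covec.span_base) auto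
      have "(\<Sum>j\<in>{\<sigma><..<r}. (\<lambda>q. (- m' j) * ?c j q)) \<in> N"
        unfolding N_def by (intro covec.span_sum covec.span_scale covec.span_base) auto
      then show "(\<lambda>q. \<delta>' * ?c r q) + (\<Sum>j\<in>{\<sigma><..<r}. (\<lambda>q. (- m' j) * ?c j q)) \<in> N"
        using cN[of r] by (intro Nadd Nscale)
      fix q
      have set: "{..<r} = insert \<sigma> ({..<\<sigma>} \<union> {\<sigma><..<r})" using \<sigma>(1) by auto
      have "\<delta> * ?c r q = m \<sigma> * ?c \<sigma> q + ((\<Sum>j<\<sigma>. m j * ?c j q) + (\<Sum>j\<in>{\<sigma><..<r}. m j * ?c j q))"
        unfolding rel set by (subst sum.insert) (auto intro!: sum.union_disjoint)
      moreover have "(\<Sum>j\<in>{\<sigma><..<r}. m j * ?c j q) = \<pi> * (\<Sum>j\<in>{\<sigma><..<r}. m' j * ?c j q)"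
        unfolding sum_distrib_left by (intro sum.cong) (auto simp: m' mult.assoc)
      ultimately show "m \<sigma> * ?c \<sigma> q = (\<Sum>j<\<sigma>. (\<lambda>q. (- m j) * ?c j q)) q
         + \<pi> ^ 1 * ((\<lambda>q. \<delta>' * ?c r q) + (\<Sum>j\<in>{\<sigma><..<r}. (\<lambda>q. (- m' j) * ?c j q))) q"
        by (simp add: sum_fun_apply \<delta>' algebra_simps sum_negf)
    qed
  qed
  have ED: "E 1 (?D v)" if "E 1 v" for v
  proof -
    from that obtain a l x where h: "\<not> \<pi> dvd a" "l \<in> L" "x \<in> N" "\<And>q. a * v q = l q + \<pi> ^ 1 * x q"
      unfolding E_def by metis
    have EDl: "E 1 (?D l)"
      using h(2) unfolding L_def
    proof (induction rule: covec.span_induct_alt)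
      case base
      show ?case unfolding dual_deriv_zero by (rule EL) (simp only: L_def covec.span_zero)
    next
      case (step b c y)
      from step(1) obtain j where j: "c = ?c j" "j < \<sigma>" by auto
      have "E 1 (?D c)" using Ec0[of "Suc j"] E\<sigma> j
        by (cases "Suc j = \<sigma>") (auto simp: jet_row_Suc[symmetric])
      then have "E 1 (\<lambda>q. (pderiv b * c q + b * ?D c q) + ?D y q)"
        using step(2) Ec0[of j] j by (intro Eadd Escale) auto
      then show ?case
        using dual_deriv_add[of n A "\<lambda>q. b * c q" y] dual_deriv_scale[of n A b c]
        by (simp add: plus_fun_def)
    qed
    have "?D (\<lambda>q. a * v q) = ?D (\<lambda>q. l q + \<pi> * x q)" using h(4) by simp
    then have "a * ?D v q = ?D l q + \<pi> * ?D x q + (- pderiv a) * v q" for q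
      unfolding dual_deriv_add dual_deriv_scale \<pi>0
      by (metis (no_types, lifting) add.commute add_0 add_diff_cancel_left' minus_mult_left mult_zero_left uminus_add_conv_diff)
    then have "(\<lambda>q. a * ?D v q) = (\<lambda>q. (?D l q + \<pi> * ?D x q) + (- pderiv a) * v q)" by auto
    moreover have "E 1 (\<lambda>q. (?D l q + \<pi> * ?D x q) + (- pderiv a) * v q)"
      using EDl DN[OF h(3)] that by (intro Eadd Escale E\<pi>)
    ultimately show ?thesis using Ecancel[OF h(1), of "?D v"] by simp
  qed
  have Ec: "E 1 (?c k)" for k
  proof (induction k)
    case 0
    show ?case using Ec0[of 0] E\<sigma> by (cases "\<sigma> = 0") auto
  next
    case (Suc k)
    then show ?case using ED by (simp add: jet_row_Suc)
  qed
  have EN: "E 1 v" if "v \<in> N" for v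
    using that unfolding N_def
  proof (induction rule: covec.span_induct_alt)
    case base
    show ?case by (rule EL) (simp only: L_def covec.span_zero)
  next
    case (step b c y)
    then have "E 1 (\<lambda>q. b * c q + y q)" using Ec by (intro Eadd Escale) auto
    then show ?case by (simp add: plus_fun_def)
  qed
  have Ei: "E i v" if "v \<in> N" for i v
    using that
  proof (induction i arbitrary: v)
    case 0
    show ?case by (rule EI[of 1 "\<lambda>q. 0" v]) (use 0 \<pi>1 covec.span_zero in \<open>auto simp: L_def zero_fun_def\<close>)
  next
    case (Suc i)
    from Suc.IH[OF Suc.prems] obtain a l x where h: "\<not> \<pi> dvd a" "l \<in> L" "x \<in> N"
      "\<And>q. a * v q = l q + \<pi> ^ i * x q" unfolding E_def by metis
    from EN[OF h(3)] obtain a' l' x' where h': "\<not> \<pi> dvd a'" "l' \<in> L" "x' \<in> N"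
      "\<And>q. a' * x q = l' q + \<pi> ^ 1 * x' q" unfolding E_def by metis
    show ?case
    proof (rule EI)
      show "\<not> \<pi> dvd a' * a" using h h' \<pi> by (simp add: prime_elem_dvd_mult_iff)
      show "(\<lambda>q. a' * l q) + (\<lambda>q. \<pi> ^ i * l' q) \<in> L" using h h' by (intro Ladd Lscale)
      show "x' \<in> N" by fact
      fix q
      have "a' * a * v q = a' * (a * v q)" by (simp add: algebra_simps)
      also have "\<dots> = a' * l q + \<pi> ^ i * (a' * x q)" unfolding h by (simp add: algebra_simps)
      finally show "a' * a * v q = ((\<lambda>q. a' * l q) + (\<lambda>q. \<pi> ^ i * l' q)) q + \<pi> ^ Suc i * x' q"
        unfolding h' by (simp add: algebra_simps)
    qed
  qed
  have "\<pi> ^ i dvd \<Delta>" for i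
  proof -
    from Ei[OF cN, of i \<sigma>] obtain a l x where h: "\<not> \<pi> dvd a" "l \<in> L" "x \<in> N"
      "\<And>q. a * ?c \<sigma> q = l q + \<pi> ^ i * x q" unfolding E_def by metis
    have "(\<Sum>j<r. Y \<sigma> j * l (\<phi> j)) = 0"
      using h(2) unfolding L_def
      by (rule covec_functional_span) (use dual[of _ \<sigma>] \<sigma> in auto)
    then have "a * \<Delta> = \<pi> ^ i * (\<Sum>j<r. Y \<sigma> j * x (\<phi> j))"
      using dual[OF \<sigma>(1) \<sigma>(1)]
    proof -
      have "a * \<Delta> = (\<Sum>j<r. Y \<sigma> j * (a * ?c \<sigma> (\<phi> j)))"
        using dual[OF \<sigma>(1) \<sigma>(1)] by (simp add: sum_distrib_left algebra_simps flip: sum_distrib_left)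
      also have "\<dots> = (\<Sum>j<r. Y \<sigma> j * l (\<phi> j)) + \<pi> ^ i * (\<Sum>j<r. Y \<sigma> j * x (\<phi> j))"
        unfolding h(4) by (simp add: algebra_simps sum.distrib sum_distrib_left)
      finally show ?thesis using \<open>(\<Sum>j<r. Y \<sigma> j * l (\<phi> j)) = 0\<close> by simp
    qed
    then have d: "\<pi> ^ i dvd a * \<Delta>" by simp
    obtain b b' where b: "b + b' = i" "\<pi> ^ b dvd a" "\<pi> ^ b' dvd \<Delta>"
      using prime_elem_power_dvd_prod[OF d \<pi>] by blast
    have "b = 0"
      using b(2) h(1) dvd_trans[OF dvd_power[of b \<pi>], of a] by (cases "b = 0") auto
    then show ?thesis using b by simp
  qed
  moreover have "\<not> is_unit \<pi>" "\<pi> \<noteq> 0" using \<pi> by auto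
  ultimately have "\<Delta> = 0"
    using finite_divisor_powers[of \<Delta> \<pi>] by auto
  then show False using \<Delta> by simp
qed

section \<open>Primitive equations and Bezout identities\<close>

text \<open>
  A common factor \<open>h\<close> of largest degree is split off; a prime dividing everything that remains could be
  moved into it.
\<close>

lemma split_off_common_factor:
  fixes \<delta> :: "'a :: field poly poly"
  assumes \<delta>: "\<delta> \<noteq> 0"
  shows "\<exists>h \<delta>' m'. h \<noteq> 0 \<and> \<delta> = [:h:] * \<delta>' \<and> (\<forall>j<r. m j = [:h:] * m' j)
     \<and> (\<forall>p. prime_elem p \<longrightarrow> [:p:] dvd \<delta>' \<longrightarrow> (\<exists>j<r. \<not> [:p:] dvd m' j))"
proof -
  define Q where "Q h \<longleftrightarrow> h \<noteq> 0 \<and> [:h:] dvd \<delta> \<and> (\<forall>j<r. [:h:] dvd m j)" for h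
  have "Q 1" by (simp add: Q_def flip: one_pCons)
  moreover have "degree h < Suc (degree (lead_coeff \<delta>))" if "Q h" for h
  proof -
    have "h dvd lead_coeff \<delta>" using that by (auto simp: Q_def const_poly_dvd_iff)
    then show ?thesis using \<delta> by (simp add: dvd_imp_degree_le less_Suc_eq_le)
  qed
  ultimately obtain h where h: "Q h" "\<And>h'. Q h' \<Longrightarrow> degree h' \<le> degree h"
    using ex_has_greatest_nat[of Q 1 degree "Suc (degree (lead_coeff \<delta>))"] by blast
  obtain \<delta>' where \<delta>': "\<delta> = [:h:] * \<delta>'" using h(1) by (auto simp: Q_def elim: dvdE)
  have "\<forall>j. \<exists>x. j < r \<longrightarrow> m j = [:h:] * x" using h(1) by (auto simp: Q_def dvd_def simp del: mult_pCons_left)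
  then obtain m' where m': "\<And>j. j < r \<Longrightarrow> m j = [:h:] * m' j" by metis
  have "\<exists>j<r. \<not> [:p:] dvd m' j" if p: "prime_elem p" "[:p:] dvd \<delta>'" for p
  proof (rule ccontr)
    assume "\<not> ?thesis"
    then have all: "[:p:] dvd m' j" if "j < r" for j using that by blast
    have hp: "[:h * p:] = [:h:] * [:p:]" by simp
    have "Q (h * p)"
      unfolding Q_def hp \<delta>'
    proof (intro conjI allI impI)
      show "h * p \<noteq> 0" using h(1) p(1) by (auto simp: Q_def)
      show "[:h:] * [:p:] dvd [:h:] * \<delta>'" using p(2) by (intro mult_dvd_mono) auto
      show "[:h:] * [:p:] dvd m j" if "j < r" for j
        unfolding m'[OF that] using all[OF that] by (intro mult_dvd_mono) auto
    qed
    then have "degree (h * p) \<le> degree h" by (rule h(2))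
    moreover have "p \<noteq> 0" "h \<noteq> 0" using p(1) h(1) by (auto simp: Q_def)
    ultimately have "degree p = 0" by (simp add: degree_mult_eq)
    then have "is_unit p" using \<open>p \<noteq> 0\<close> by (simp add: is_unit_iff_degree)
    then show False using p(1) by auto
  qed
  then show ?thesis using h(1) \<delta>' m' unfolding Q_def by blast
qed

text \<open>
  The ideal generated by the coefficients is principal, and a generator, taken of least degree, divides
  all of them; a prime factor of it would divide the whole polynomial.
\<close>

lemma primitive_bezout:
  fixes q :: "'a :: field_gcd poly poly"
  assumes prim: "\<And>p. prime_elem p \<Longrightarrow> \<not> [:p:] dvd q" and q: "q \<noteq> 0"
  shows "\<exists>u. (\<Sum>i\<le>degree q. u i * coeff q i) = 1"
proof -
  define S where "S u = (\<Sum>i\<le>degree q. u i * coeff q i)" for u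
  have Sadd: "S (\<lambda>i. a * u i + b * v i) = a * S u + b * S v" for a b u v
    unfolding S_def by (simp add: sum.distrib sum_distrib_left algebra_simps)
  have Sone: "S (\<lambda>i. if i = k then 1 else 0) = coeff q k" for k
  proof (cases "k \<le> degree q")
    case True
    then show ?thesis unfolding S_def by (simp add: if_distrib[of "\<lambda>x. x * _"] cong: if_cong)
  next
    case False
    then show ?thesis unfolding S_def by (auto simp: coeff_eq_0 intro!: sum.neutral)
  qed
  have "S (\<lambda>i. if i = degree q then 1 else 0) \<noteq> 0" using q by (simp add: Sone)
  then obtain u where u: "S u \<noteq> 0" "\<And>v. S v \<noteq> 0 \<Longrightarrow> degree (S u) \<le> degree (S v)"
    using ex_has_least_nat[of "\<lambda>u. S u \<noteq> 0" _ "\<lambda>u. degree (S u)"] by blast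
  have dvd: "S u dvd coeff q k" for k
  proof -
    let ?v = "\<lambda>i. 1 * (if i = k then 1 else 0) + (- (coeff q k div S u)) * u i"
    have "S ?v = coeff q k - coeff q k div S u * S u" unfolding Sadd Sone by simp
    then have v: "S ?v = coeff q k mod S u" by (simp add: minus_div_mult_eq_mod)
    have "coeff q k mod S u = 0"
    proof (rule ccontr)
      assume "coeff q k mod S u \<noteq> 0"
      then have "degree (S u) \<le> degree (coeff q k mod S u)" using u(2)[of ?v] v by simp
      moreover have "degree (coeff q k mod S u) < degree (S u)"
        using degree_mod_less[OF u(1), of "coeff q k"] \<open>coeff q k mod S u \<noteq> 0\<close> by simp
      ultimately show False by simp
    qed
    then show ?thesis by auto
  qed
  have "is_unit (S u)"
  proof (rule ccontr)
    assume "\<not> is_unit (S u)"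
    then obtain p where p: "p dvd S u" "prime p" using prime_divisor_exists[OF u(1)] by auto
    then have "[:p:] dvd q" using dvd dvd_trans by (auto simp: const_poly_dvd_iff)
    then show False using prim p(2) by auto
  qed
  then obtain w where w: "1 = S u * w" by (auto elim: dvdE)
  have "S (\<lambda>i. w * u i + 0 * u i) = 1" unfolding Sadd using w by (simp add: mult.commute)
  then show ?thesis unfolding S_def by (rule exI[of _ "\<lambda>i. w * u i + 0 * u i"])
qed

text \<open>
  All multipliers but one are reduced modulo a fixed nonzero \<open>a\<^sub>k\<close>; the remaining one absorbs the
  quotients, and its degree is then bounded by comparing degrees in the identity itself.
\<close>

lemma bezout_degree_reduction:
  fixes a :: "nat \<Rightarrow> 'a :: field poly"
  assumes a: "\<And>i. i \<le> D \<Longrightarrow> degree (a i) \<le> D" and k: "k \<le> D" "a k \<noteq> 0"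
    and b: "degree b \<le> D" "b = (\<Sum>i\<le>D. u i * a i)"
  shows "\<exists>v. b = (\<Sum>i\<le>D. v i * a i) \<and> (\<forall>i\<le>D. degree (v i) \<le> 2 * D)"
proof -
  define v where "v i = (if i = k then u k + (\<Sum>j\<in>{..D}-{k}. (u j div a k) * a j) else u i mod a k)" for i
  have split: "(\<Sum>i\<le>D. f i) = f k + (\<Sum>i\<in>{..D}-{k}. f i)" for f :: "nat \<Rightarrow> 'a poly"
    using k by (simp add: sum.remove)
  have "(\<Sum>i\<le>D. v i * a i) = v k * a k + (\<Sum>i\<in>{..D}-{k}. (u i mod a k) * a i)"
    unfolding split by (simp add: v_def)
  also have "v k * a k = u k * a k + (\<Sum>i\<in>{..D}-{k}. (u i div a k) * a k * a i)"
    by (simp add: v_def algebra_simps sum_distrib_left sum_distrib_right)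
  also have "u k * a k + (\<Sum>i\<in>{..D}-{k}. (u i div a k) * a k * a i) + (\<Sum>i\<in>{..D}-{k}. (u i mod a k) * a i)
      = u k * a k + (\<Sum>i\<in>{..D}-{k}. ((u i div a k) * a k + u i mod a k) * a i)"
    by (simp only: distrib_right sum.distrib add.assoc)
  also have "\<dots> = b" unfolding b(2) split by simp
  finally have bv: "b = (\<Sum>i\<le>D. v i * a i)" ..
  have dv: "degree (v i) \<le> D" if "i \<noteq> k" for i
    using degree_mod_less[OF k(2), of "u i"] a[OF k(1)] that by (auto simp: v_def)
  have "degree (v k) \<le> 2 * D"
  proof (cases "v k = 0")
    case False
    have "v k * a k = b - (\<Sum>i\<in>{..D}-{k}. v i * a i)" using bv unfolding split by simp
    also have "degree \<dots> \<le> 2 * D"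
    proof (rule degree_diff_le)
      show "degree b \<le> 2 * D" using b by simp
      show "degree (\<Sum>i\<in>{..D}-{k}. v i * a i) \<le> 2 * D"
      proof (rule degree_sum_le)
        fix i assume i: "i \<in> {..D} - {k}"
        then show "degree (v i * a i) \<le> 2 * D"
          using degree_mult_le[of "v i" "a i"] dv[of i] a[of i] by simp
      qed simp
    qed
    finally show ?thesis using False k(2) by (simp add: degree_mult_eq)
  qed simp
  then show ?thesis using bv dv by (metis le_trans mult_2 le_add1)
qed

section \<open>Small solutions of integer linear systems\<close>

lemma abs_det_le:
  fixes B :: "real mat"
  assumes "B \<in> carrier_mat s s" "\<And>i j. i < s \<Longrightarrow> j < s \<Longrightarrow> \<bar>B $$ (i, j)\<bar> \<le> G"
  shows "\<bar>Determinant.det B\<bar> \<le> fact s * G ^ s"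
proof -
  have "\<bar>Determinant.det B\<bar> \<le> (\<Sum>p\<in>{p. p permutes {0..<s}}. \<bar>signof p * (\<Prod>i=0..<s. B $$ (i, p i))\<bar>)"
    unfolding det_def'[OF assms(1)] by (rule sum_abs)
  also have "\<dots> \<le> (\<Sum>p\<in>{p. p permutes {0..<s}}. G ^ s)"
  proof (rule sum_mono)
    fix p assume p: "p \<in> {p. p permutes {0..<s}}"
    have "\<bar>signof p * (\<Prod>i=0..<s. B $$ (i, p i))\<bar> = (\<Prod>i=0..<s. \<bar>B $$ (i, p i)\<bar>)"
      by (simp add: abs_mult abs_prod sign_def)
    also have "\<dots> \<le> (\<Prod>i=0..<s. G)"
    proof (intro prod_mono conjI assms(2))
      fix i assume "i \<in> {0..<s}"
      then show "p i < s" "i < s" using p permutes_in_image[of p "{0..<s}" i] by auto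
    qed auto
    finally show "\<bar>signof p * (\<Prod>i=0..<s. B $$ (i, p i))\<bar> \<le> G ^ s" by simp
  qed
  also have "\<dots> = fact s * G ^ s" by (simp add: card_permutations)
  finally show ?thesis .
qed

lemma det_Ints:
  fixes B :: "real mat"
  assumes "B \<in> carrier_mat s s" "\<And>i j. i < s \<Longrightarrow> j < s \<Longrightarrow> B $$ (i, j) \<in> \<int>"
  shows "Determinant.det B \<in> \<int>"
  unfolding det_def'[OF assms(1)]
proof (intro Ints_sum)
  fix p assume p: "p \<in> {p. p permutes {0..<s}}"
  have "(\<Prod>i=0..<s. B $$ (i, p i)) \<in> \<int>"
  proof (intro Ints_prod assms(2))
    fix i assume "i \<in> {0..<s}"
    then show "p i < s" "i < s" using p permutes_in_image[of p "{0..<s}" i] by auto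
  qed
  then show "signof p * (\<Prod>i=0..<s. B $$ (i, p i)) \<in> \<int>" by (simp add: sign_def)
qed

text \<open>
  A solution of least support has linearly independent columns on its support, so that it is the only
  solution there and is given by Cramer's rule for the Gram matrix of these columns. The
  denominator is a nonzero integer and can only help.
\<close>

lemma exists_bounded_solution:
  fixes b :: "'i \<Rightarrow> 'j \<Rightarrow> real"
  assumes fin: "finite I" "finite J" "I \<noteq> {}" and H: "H \<ge> 1"
    and bI: "\<And>i j. i \<in> I \<Longrightarrow> j \<in> J \<Longrightarrow> b i j \<in> \<int> \<and> \<bar>b i j\<bar> \<le> H"
    and wI: "\<And>i. i \<in> I \<Longrightarrow> w i \<in> \<int> \<and> \<bar>w i\<bar> \<le> H"
    and sol: "\<And>i. i \<in> I \<Longrightarrow> (\<Sum>j\<in>J. b i j * u0 j) = w i"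
  shows "\<exists>u. (\<forall>i\<in>I. (\<Sum>j\<in>J. b i j * u j) = w i) \<and>
     (\<forall>j\<in>J. \<bar>u j\<bar> \<le> (real (card J) * (real (card I) * H\<^sup>2)) ^ card J)"
proof -
  define Q where "Q u \<longleftrightarrow> (\<forall>i\<in>I. (\<Sum>j\<in>J. b i j * u j) = w i)" for u
  define S where "S u = {j \<in> J. u j \<noteq> 0}" for u :: "'j \<Rightarrow> real"
  have finS: "finite (S u)" for u using fin by (simp add: S_def)
  have "Q u0" using sol by (simp add: Q_def)
  then obtain u where u: "Q u" "\<And>v. Q v \<Longrightarrow> card (S u) \<le> card (S v)"
    using ex_has_least_nat[of Q u0 "\<lambda>u. card (S u)"] by blast
  define s where "s = card (S u)"
  obtain e where e: "bij_betw e {0..<s} (S u)"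
    using ex_bij_betw_nat_finite[OF finS] unfolding s_def by blast
  have eJ: "e a \<in> J" "u (e a) \<noteq> 0" if "a < s" for a
    using bij_betwE[OF e] that by (auto simp: S_def)
  have sumS: "(\<Sum>j\<in>S u. f j) = (\<Sum>a=0..<s. f (e a))" for f :: "'j \<Rightarrow> real"
    using sum.reindex_bij_betw[OF e, of f] by simp
  define M where "M = Matrix.mat s s (\<lambda>(a,c). \<Sum>i\<in>I. b i (e a) * b i (e c))"
  have M: "M \<in> carrier_mat s s" by (simp add: M_def)
  define G where "G = real (card I) * H\<^sup>2"
  have cI: "real (card I) \<ge> 1" using fin by (simp add: Suc_le_eq card_gt_0_iff)
  have H2: "H\<^sup>2 \<ge> 1" using H by simp
  have G1: "G \<ge> 1" unfolding G_def using cI H2 mult_mono[of 1 "real (card I)" 1 "H\<^sup>2"] by simp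
  have bG: "\<bar>\<Sum>i\<in>I. x i * y i\<bar> \<le> G" if "\<And>i. i \<in> I \<Longrightarrow> \<bar>x i\<bar> \<le> H" "\<And>i. i \<in> I \<Longrightarrow> \<bar>y i\<bar> \<le> H" for x y
  proof -
    have "\<bar>\<Sum>i\<in>I. x i * y i\<bar> \<le> (\<Sum>i\<in>I. H * H)"
      using that H by (intro order_trans[OF sum_abs] sum_mono) (auto simp: abs_mult intro!: mult_mono)
    then show ?thesis by (simp add: G_def power2_eq_square)
  qed
  \<comment> \<open>minimality of the support makes the columns independent, hence the Gram matrix regular\<close>
  have detM: "Determinant.det M \<noteq> 0"
  proof
    assume "Determinant.det M = 0"
    then obtain v where v: "v \<in> carrier_vec s" "v \<noteq> 0\<^sub>v s" "M *\<^sub>v v = 0\<^sub>v s"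
      using det_0_iff_vec_prod_zero[OF M] by blast
    have Mv: "(\<Sum>c=0..<s. (\<Sum>i\<in>I. b i (e a) * b i (e c)) * v $ c) = 0" if "a < s" for a
    proof -
      have "(M *\<^sub>v v) $ a = 0" using v(3) that by simp
      then show ?thesis using that v(1) by (simp add: M_def scalar_prod_def)
    qed
    have "(\<Sum>i\<in>I. (\<Sum>a=0..<s. b i (e a) * v $ a)\<^sup>2)
        = (\<Sum>a=0..<s. v $ a * (\<Sum>c=0..<s. (\<Sum>i\<in>I. b i (e a) * b i (e c)) * v $ c))"
    proof -
      have "(\<Sum>i\<in>I. (\<Sum>a=0..<s. b i (e a) * v $ a)\<^sup>2)
          = (\<Sum>i\<in>I. \<Sum>a=0..<s. \<Sum>c=0..<s. (b i (e a) * v $ a) * (b i (e c) * v $ c))"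
        by (simp add: power2_eq_square sum_product)
      also have "\<dots> = (\<Sum>a=0..<s. \<Sum>i\<in>I. \<Sum>c=0..<s. (b i (e a) * v $ a) * (b i (e c) * v $ c))"
        by (rule sum.swap)
      also have "\<dots> = (\<Sum>a=0..<s. \<Sum>c=0..<s. \<Sum>i\<in>I. (b i (e a) * v $ a) * (b i (e c) * v $ c))"
        by (intro sum.cong refl sum.swap)
      finally show ?thesis by (simp add: sum_distrib_left sum_distrib_right mult_ac)
    qed
    also have "\<dots> = 0" using Mv by simp
    finally have Bv: "(\<Sum>a=0..<s. b i (e a) * v $ a) = 0" if "i \<in> I" for i
      using that fin(1) by (simp add: sum_nonneg_eq_0_iff)
    obtain a0 where a0: "a0 < s" "v $ a0 \<noteq> 0" using v(1,2) by (metis carrier_vecD eq_vecI index_zero_vec(1) index_zero_vec(2))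
    define d where "d j = (if j \<in> S u then v $ (inv_into {0..<s} e j) else 0)" for j
    have de: "d (e a) = v $ a" if "a < s" for a
      using that bij_betwE[OF e] bij_betw_inv_into_left[OF e] by (auto simp: d_def)
    \<comment> \<open>a kernel vector \<open>d\<close> supported in \<open>S u\<close>; subtracting \<open>\<tau> d\<close> removes \<open>e a0\<close> from the support\<close>
    define \<tau> where "\<tau> = u (e a0) / v $ a0"
    define u' where "u' j = u j - \<tau> * d j" for j
    have "Q u'"
      unfolding Q_def
    proof
      fix i assume i: "i \<in> I"
      have "(\<Sum>j\<in>J. b i j * d j) = (\<Sum>j\<in>S u. b i j * d j)"
        using fin by (intro sum.mono_neutral_right) (auto simp: S_def d_def)
      also have "\<dots> = 0" unfolding sumS using Bv[OF i] de by simp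
      finally have "(\<Sum>j\<in>J. b i j * d j) = 0" .
      moreover have "(\<Sum>j\<in>J. b i j * u' j) = (\<Sum>j\<in>J. b i j * u j) - \<tau> * (\<Sum>j\<in>J. b i j * d j)"
        by (simp add: u'_def algebra_simps sum_subtractf sum_distrib_left)
      ultimately show "(\<Sum>j\<in>J. b i j * u' j) = w i" using u(1) i by (simp add: Q_def)
    qed
    moreover have "S u' \<subset> S u"
    proof
      show "S u' \<subseteq> S u" by (auto simp: S_def u'_def d_def)
      have "e a0 \<in> S u" "e a0 \<notin> S u'"
        using a0 de[OF a0(1)] eJ[OF a0(1)] by (auto simp: S_def u'_def \<tau>_def)
      then show "S u' \<noteq> S u" by blast
    qed
    ultimately show False using u(2) psubset_card_mono[OF finS] by (meson not_less)
  qed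
  have "Determinant.det M \<in> \<int>"
    by (rule det_Ints[OF M]) (use bI eJ in \<open>auto simp: M_def intro!: Ints_sum\<close>)
  then have det1: "\<bar>Determinant.det M\<bar> \<ge> 1" using detM by (rule Ints_nonzero_abs_ge1)
  define y where "y = Matrix.vec s (\<lambda>a. u (e a))"
  define z where "z = Matrix.vec s (\<lambda>a. \<Sum>i\<in>I. b i (e a) * w i)"
  have My: "M *\<^sub>v y = z"
  proof (rule eq_vecI)
    fix a assume "a < dim_vec z"
    then have a: "a < s" by (simp add: z_def)
    have "(\<Sum>c=0..<s. b i (e c) * u (e c)) = w i" if "i \<in> I" for i
    proof -
      have "(\<Sum>j\<in>J. b i j * u j) = (\<Sum>j\<in>S u. b i j * u j)"
        using fin by (intro sum.mono_neutral_right) (auto simp: S_def)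
      then show ?thesis using u(1) that unfolding Q_def sumS by simp
    qed
    then have "(\<Sum>i\<in>I. b i (e a) * w i) = (\<Sum>i\<in>I. b i (e a) * (\<Sum>c=0..<s. b i (e c) * u (e c)))" by simp
    also have "\<dots> = (\<Sum>c=0..<s. (\<Sum>i\<in>I. b i (e a) * b i (e c)) * u (e c))"
      by (simp add: sum_distrib_left sum_distrib_right mult_ac sum.swap[of _ I])
    finally show "(M *\<^sub>v y) $ a = z $ a"
      using a by (simp add: M_def y_def z_def scalar_prod_def)
  qed (simp add: M_def z_def)
  have bound: "\<bar>u (e a)\<bar> \<le> fact s * G ^ s" if a: "a < s" for a
  proof -
    have "adj_mat M *\<^sub>v z = (adj_mat M * M) *\<^sub>v y"
      unfolding My[symmetric] using adj_mat(1)[OF M] M by (simp add: y_def assoc_mult_mat_vec[of _ s s _ s])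
    also have "\<dots> = Determinant.det M \<cdot>\<^sub>v y"
      unfolding adj_mat(3)[OF M]
      by (rule eq_vecI) (auto simp: y_def scalar_prod_def if_distrib[of "\<lambda>x. x * _"] if_distrib[of "\<lambda>x. _ * x"] cong: if_cong)
    finally have "(Determinant.det M \<cdot>\<^sub>v y) $ a = (adj_mat M *\<^sub>v z) $ a" by simp
    then have eq: "Determinant.det M * u (e a) = (\<Sum>c=0..<s. adj_mat M $$ (a, c) * z $ c)"
      using a adj_mat(1)[OF M] by (simp add: y_def z_def scalar_prod_def)
    have "\<bar>u (e a)\<bar> \<le> \<bar>Determinant.det M\<bar> * \<bar>u (e a)\<bar>" using det1 by (simp add: mult_le_cancel_right1)
    also have "\<dots> = \<bar>\<Sum>c=0..<s. adj_mat M $$ (a, c) * z $ c\<bar>" unfolding abs_mult[symmetric] eq ..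
    also have "\<dots> \<le> (\<Sum>c=0..<s. (fact (s - 1) * G ^ (s - 1)) * G)"
    proof (intro order_trans[OF sum_abs] sum_mono)
      fix c assume c: "c \<in> {0..<s}"
      have "\<bar>adj_mat M $$ (a, c)\<bar> = \<bar>Determinant.det (mat_delete M c a)\<bar>"
        using a c M by (simp add: adj_mat_def cofactor_def abs_mult)
      also have "\<dots> \<le> fact (s - 1) * G ^ (s - 1)"
      proof (rule abs_det_le)
        show "mat_delete M c a \<in> carrier_mat (s - 1) (s - 1)" using M by (rule mat_delete_carrier)
        fix i j assume ij: "i < s - 1" "j < s - 1"
        have idx: "(if i < c then i else Suc i) < s" "(if j < a then j else Suc j) < s" using ij by auto
        have "mat_delete M c a $$ (i, j) = M $$ (if i < c then i else Suc i, if j < a then j else Suc j)"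
          using ij M by (simp add: mat_delete_def)
        also have "\<bar>\<dots>\<bar> \<le> G"
          unfolding M_def using idx bI eJ by (simp only: index_mat prod.case) (intro bG, blast+)
        finally show "\<bar>mat_delete M c a $$ (i, j)\<bar> \<le> G" .
      qed
      finally have 1: "\<bar>adj_mat M $$ (a, c)\<bar> \<le> fact (s - 1) * G ^ (s - 1)" .
      have "\<bar>z $ c\<bar> \<le> G" using c bI wI eJ by (simp add: z_def bG)
      then show "\<bar>adj_mat M $$ (a, c) * z $ c\<bar> \<le> (fact (s - 1) * G ^ (s - 1)) * G"
        unfolding abs_mult using 1 G1 by (intro mult_mono) auto
    qed
    also have "\<dots> = (real s * fact (s - 1)) * (G ^ (s - 1) * G)" by simp
    also have "\<dots> = fact s * G ^ s" using a by (cases s) auto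
    finally show ?thesis .
  qed
  have "\<bar>u j\<bar> \<le> (real (card J) * G) ^ card J" if j: "j \<in> J" for j
  proof (cases "j \<in> S u")
    case True
    then have "j \<in> e ` {0..<s}" using e by (simp add: bij_betw_def)
    then obtain a where a: "a < s" "j = e a" by auto
    have sJ: "s \<le> card J" unfolding s_def using fin by (intro card_mono) (auto simp: S_def)
    have "\<bar>u j\<bar> \<le> fact s * G ^ s" using bound a by simp
    also have "\<dots> \<le> real s ^ s * G ^ s"
      using G1 fact_le_power[of s, where 'a = real] by (intro mult_right_mono) auto
    also have "\<dots> = (real s * G) ^ s" by (simp add: power_mult_distrib)
    also have "\<dots> \<le> (real (card J) * G) ^ s" using sJ G1 by (intro power_mono mult_right_mono) auto
    also have "\<dots> \<le> (real (card J) * G) ^ card J"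
    proof (rule power_increasing[OF sJ])
      have "card J \<ge> 1" using sJ a by simp
      then show "1 \<le> real (card J) * G" using G1 mult_mono[of 1 "real (card J)" 1 G] by simp
    qed
    finally show ?thesis .
  next
    case False
    then show ?thesis using j G1 by (simp add: S_def)
  qed
  then show ?thesis using u(1) unfolding Q_def G_def by blast
qed

section \<open>Polynomials in two variables of bounded degree and height\<close>

text \<open>
  Submultiplicativity and the triangle inequality pass from \<open>\<nu>\<close> to the sum of the values of \<open>\<nu>\<close> at
  the coefficients of a polynomial. Doing this twice, starting from the modulus, measures polynomials
  in two variables.
\<close>

definition subnorm :: "('a::comm_ring_1 \<Rightarrow> real) \<Rightarrow> bool" where
  "subnorm \<nu> \<longleftrightarrow> \<nu> 0 = 0 \<and> (\<forall>a. 0 \<le> \<nu> a) \<and> (\<forall>a b. \<nu> (a + b) \<le> \<nu> a + \<nu> b) \<and> (\<forall>a b. \<nu> (a * b) \<le> \<nu> a * \<nu> b)"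

definition coeff_norm :: "('a::comm_ring_1 \<Rightarrow> real) \<Rightarrow> 'a poly \<Rightarrow> real" where
  "coeff_norm \<nu> p = (\<Sum>i\<le>degree p. \<nu> (coeff p i))"

lemma coeff_norm_eq:
  assumes "subnorm \<nu>" "degree p \<le> N"
  shows "coeff_norm \<nu> p = (\<Sum>i\<le>N. \<nu> (coeff p i))"
  unfolding coeff_norm_def using assms
  by (intro sum.mono_neutral_left) (auto simp: subnorm_def not_le coeff_eq_0)

lemma coeff_norm_pCons:
  assumes "subnorm \<nu>"
  shows "coeff_norm \<nu> (pCons a p) = \<nu> a + coeff_norm \<nu> p"
proof -
  have "coeff_norm \<nu> (pCons a p) = (\<Sum>i\<le>Suc (degree p). \<nu> (coeff (pCons a p) i))"
    using assms by (intro coeff_norm_eq) (auto simp: degree_pCons_le)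
  then show ?thesis by (simp add: sum.atMost_Suc_shift coeff_norm_def del: sum.atMost_Suc)
qed

lemma coeff_norm_nonneg: "subnorm \<nu> \<Longrightarrow> 0 \<le> coeff_norm \<nu> p"
  unfolding coeff_norm_def by (intro sum_nonneg) (auto simp: subnorm_def)

lemma coeff_le_coeff_norm:
  assumes "subnorm \<nu>" shows "\<nu> (coeff p k) \<le> coeff_norm \<nu> p"
proof -
  have "coeff_norm \<nu> p = (\<Sum>i\<le>max k (degree p). \<nu> (coeff p i))"
    using assms by (intro coeff_norm_eq) auto
  also have "\<dots> \<ge> \<nu> (coeff p k)" using assms by (intro member_le_sum) (auto simp: subnorm_def)
  finally show ?thesis .
qed

lemma subnorm_coeff_norm:
  assumes \<nu>: "subnorm \<nu>"
  shows "subnorm (coeff_norm \<nu>)"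
proof -
  have add: "coeff_norm \<nu> (p + q) \<le> coeff_norm \<nu> p + coeff_norm \<nu> q" for p q
  proof -
    let ?N = "max (degree p) (degree q)"
    have "coeff_norm \<nu> (p + q) = (\<Sum>i\<le>?N. \<nu> (coeff (p + q) i))"
      using \<nu> by (intro coeff_norm_eq degree_add_le) auto
    also have "\<dots> \<le> (\<Sum>i\<le>?N. \<nu> (coeff p i) + \<nu> (coeff q i))"
      using \<nu> by (intro sum_mono) (auto simp: subnorm_def)
    also have "\<dots> = coeff_norm \<nu> p + coeff_norm \<nu> q"
      using coeff_norm_eq[OF \<nu>, of p ?N] coeff_norm_eq[OF \<nu>, of q ?N] by (simp add: sum.distrib)
    finally show ?thesis .
  qed
  have smult: "coeff_norm \<nu> (Polynomial.smult a q) \<le> \<nu> a * coeff_norm \<nu> q" for a q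
  proof -
    have "coeff_norm \<nu> (Polynomial.smult a q) = (\<Sum>i\<le>degree q. \<nu> (a * coeff q i))"
      using coeff_norm_eq[OF \<nu> degree_smult_le, of a q] by simp
    also have "\<dots> \<le> (\<Sum>i\<le>degree q. \<nu> a * \<nu> (coeff q i))"
      using \<nu> by (intro sum_mono) (auto simp: subnorm_def)
    finally show ?thesis by (simp add: coeff_norm_def sum_distrib_left)
  qed
  have "coeff_norm \<nu> (p * q) \<le> coeff_norm \<nu> p * coeff_norm \<nu> q" for p q
  proof (induction p)
    case 0
    show ?case using \<nu> by (simp add: coeff_norm_def subnorm_def)
  next
    case (pCons a p)
    have "coeff_norm \<nu> (pCons a p * q) \<le> coeff_norm \<nu> (Polynomial.smult a q) + coeff_norm \<nu> (pCons 0 (p * q))"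
      by (simp add: add)
    also have "coeff_norm \<nu> (pCons 0 (p * q)) = coeff_norm \<nu> (p * q)"
      using \<nu> by (simp add: coeff_norm_pCons subnorm_def)
    also have "\<dots> \<le> coeff_norm \<nu> p * coeff_norm \<nu> q" by fact
    finally show ?case using smult[of a q] by (simp add: coeff_norm_pCons[OF \<nu>] algebra_simps)
  qed
  then show ?thesis
    unfolding subnorm_def using add coeff_norm_nonneg[OF \<nu>] \<nu> by (auto simp: coeff_norm_def subnorm_def)
qed

lemma subnorm_of_nat_mult:
  assumes "subnorm \<nu>" shows "\<nu> (of_nat k * a) \<le> real k * \<nu> a"
proof (induction k)
  case (Suc k)
  have "\<nu> (of_nat k * a + a) \<le> \<nu> (of_nat k * a) + \<nu> a" using assms by (auto simp: subnorm_def)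
  then show ?case using Suc by (simp add: algebra_simps)
qed (use assms in \<open>auto simp: subnorm_def\<close>)

lemma coeff_norm_pderiv:
  fixes p :: "'a::idom poly"
  assumes "subnorm \<nu>" "degree p \<le> N"
  shows "coeff_norm \<nu> (pderiv p) \<le> real N * coeff_norm \<nu> p"
proof -
  have \<nu>0: "0 \<le> \<nu> a" for a using assms by (auto simp: subnorm_def)
  have "coeff_norm \<nu> (pderiv p) = (\<Sum>i\<le>degree p. \<nu> (coeff (pderiv p) i))"
    using assms by (intro coeff_norm_eq degree_le) (auto simp: coeff_pderiv coeff_eq_0)
  also have "\<dots> \<le> (\<Sum>i\<le>degree p. real N * \<nu> (coeff p (Suc i)))"
  proof (rule sum_mono)
    fix i assume "i \<in> {..degree p}"
    show "\<nu> (coeff (pderiv p) i) \<le> real N * \<nu> (coeff p (Suc i))"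
    proof (cases "Suc i \<le> N")
      case True
      have "\<nu> (coeff (pderiv p) i) \<le> real (Suc i) * \<nu> (coeff p (Suc i))"
        using subnorm_of_nat_mult[OF assms(1), of "Suc i"] by (simp add: coeff_pderiv)
      also have "\<dots> \<le> real N * \<nu> (coeff p (Suc i))" using True \<nu>0 by (intro mult_right_mono) auto
      finally show ?thesis .
    next
      case False
      then have "coeff p (Suc i) = 0" using assms(2) by (intro coeff_eq_0) auto
      then show ?thesis using assms(1) by (simp add: coeff_pderiv subnorm_def)
    qed
  qed
  also have "\<dots> = real N * (\<Sum>i\<le>degree p. \<nu> (coeff p (Suc i)))" by (simp add: sum_distrib_left)
  also have "(\<Sum>i\<le>degree p. \<nu> (coeff p (Suc i))) \<le> \<nu> (coeff p 0) + (\<Sum>i\<le>degree p. \<nu> (coeff p (Suc i)))"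
    using \<nu>0 by simp
  also have "\<dots> = (\<Sum>i\<le>Suc (degree p). \<nu> (coeff p i))" by (subst sum.atMost_Suc_shift) simp
  also have "\<dots> = coeff_norm \<nu> p" using assms by (intro coeff_norm_eq[symmetric]) auto
  finally show ?thesis by (simp add: mult_left_mono)
qed

text \<open>
  The height is the sum of the moduli of the coefficients rather than their maximum, because the sum
  is submultiplicative.
\<close>

definition bipoly_le :: "nat \<Rightarrow> real \<Rightarrow> real poly poly \<Rightarrow> bool" where
  "bipoly_le D H p \<longleftrightarrow> (\<forall>k l. coeff (coeff p k) l \<noteq> 0 \<longrightarrow> k + l \<le> D)
     \<and> (\<forall>k l. coeff (coeff p k) l \<in> \<int>) \<and> coeff_norm (coeff_norm abs) p \<le> H"

lemma subnorm_abs: "subnorm (abs :: real \<Rightarrow> real)"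
  by (auto simp: subnorm_def abs_mult)

lemmas subnorm2 = subnorm_coeff_norm[OF subnorm_coeff_norm[OF subnorm_abs]]
  and subnorm1 = subnorm_coeff_norm[OF subnorm_abs]

lemma bipoly_le_nonneg: "bipoly_le D H p \<Longrightarrow> 0 \<le> H"
  unfolding bipoly_le_def using coeff_norm_nonneg[OF subnorm1, of p] by linarith

lemma bipoly_le_mono: "bipoly_le D H p \<Longrightarrow> D \<le> D' \<Longrightarrow> H \<le> H' \<Longrightarrow> bipoly_le D' H' p"
  unfolding bipoly_le_def by (meson order_trans)

lemma bipoly_le_0: "0 \<le> H \<Longrightarrow> bipoly_le D H 0"
  by (simp add: bipoly_le_def coeff_norm_def)

lemma bipoly_le_1: "1 \<le> H \<Longrightarrow> bipoly_le D H 1"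
proof -
  have "coeff (coeff (1 :: real poly poly) k) l = (if k = 0 \<and> l = 0 then 1 else 0)" for k l
    by (cases k; cases l) (auto simp: one_pCons)
  then show "1 \<le> H \<Longrightarrow> bipoly_le D H 1"
    by (auto simp: bipoly_le_def coeff_norm_def)
qed

lemma bipoly_le_uminus: "bipoly_le D H p \<Longrightarrow> bipoly_le D H (- p)"
  by (auto simp: bipoly_le_def coeff_norm_def)

lemma bipoly_le_add: "bipoly_le D H p \<Longrightarrow> bipoly_le D H' q \<Longrightarrow> bipoly_le D (H + H') (p + q)"
proof -
  assume a: "bipoly_le D H p" "bipoly_le D H' q"
  have "coeff_norm (coeff_norm abs) (p + q) \<le> coeff_norm (coeff_norm abs) p + coeff_norm (coeff_norm abs) q"
    using subnorm2 unfolding subnorm_def by blast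
  moreover have "k + l \<le> D" if "coeff (coeff (p + q) k) l \<noteq> 0" for k l
  proof -
    have "coeff (coeff p k) l \<noteq> 0 \<or> coeff (coeff q k) l \<noteq> 0" using that by auto
    then show ?thesis using a unfolding bipoly_le_def by blast
  qed
  ultimately show ?thesis using a unfolding bipoly_le_def by fastforce
qed

lemma bipoly_le_sum:
  "finite S \<Longrightarrow> (\<And>x. x \<in> S \<Longrightarrow> bipoly_le D H (f x)) \<Longrightarrow> bipoly_le D (real (card S) * H) (\<Sum>x\<in>S. f x)"
proof (induction S rule: finite_induct)
  case (insert x S)
  then have "bipoly_le D (H + real (card S) * H) (f x + (\<Sum>x\<in>S. f x))" by (intro bipoly_le_add) auto
  moreover have "H + real (card S) * H = real (card (insert x S)) * H"
    using insert by (simp add: algebra_simps)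
  ultimately show ?case using insert by simp
qed (simp add: bipoly_le_0)

lemma bipoly_le_mult:
  assumes "bipoly_le D H p" "bipoly_le D' H' q"
  shows "bipoly_le (D + D') (H * H') (p * q)"
proof -
  have c: "coeff (coeff (p * q) k) l
      = (\<Sum>i\<le>k. \<Sum>j\<le>l. coeff (coeff p i) j * coeff (coeff q (k - i)) (l - j))" for k l
    by (simp add: coeff_mult coeff_sum)
  have "k + l \<le> D + D'" if nz: "coeff (coeff (p * q) k) l \<noteq> 0" for k l
  proof -
    obtain i where i: "i \<le> k" "(\<Sum>j\<le>l. coeff (coeff p i) j * coeff (coeff q (k - i)) (l - j)) \<noteq> 0"
      using nz unfolding c by (meson atMost_iff sum.not_neutral_contains_not_neutral)
    then obtain j where j: "j \<le> l" "coeff (coeff p i) j * coeff (coeff q (k - i)) (l - j) \<noteq> 0"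
      by (meson atMost_iff sum.not_neutral_contains_not_neutral)
    then have "coeff (coeff p i) j \<noteq> 0" "coeff (coeff q (k - i)) (l - j) \<noteq> 0" by auto
    then have "i + j \<le> D" "(k - i) + (l - j) \<le> D'" using assms unfolding bipoly_le_def by blast+
    then show ?thesis using i j by linarith
  qed
  moreover have "coeff (coeff (p * q) k) l \<in> \<int>" for k l
    unfolding c using assms by (intro Ints_sum Ints_mult) (auto simp: bipoly_le_def)
  moreover have "coeff_norm (coeff_norm abs) (p * q) \<le> H * H'"
  proof -
    have "coeff_norm (coeff_norm abs) (p * q) \<le> coeff_norm (coeff_norm abs) p * coeff_norm (coeff_norm abs) q"
      using subnorm2 unfolding subnorm_def by blast
    also have "\<dots> \<le> H * H'"
      using assms bipoly_le_nonneg[OF assms(1)] coeff_norm_nonneg[OF subnorm1, of q]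
      unfolding bipoly_le_def by (intro mult_mono) auto
    finally show ?thesis .
  qed
  ultimately show ?thesis unfolding bipoly_le_def by blast
qed

lemma bipoly_le_prod:
  "finite S \<Longrightarrow> (\<And>x. x \<in> S \<Longrightarrow> bipoly_le D H (f x)) \<Longrightarrow> bipoly_le (card S * D) (H ^ card S) (\<Prod>x\<in>S. f x)"
proof (induction S rule: finite_induct)
  case (insert x S)
  then show ?case using bipoly_le_mult[of D H "f x" "card S * D" "H ^ card S"] by simp
qed (simp add: bipoly_le_1)

lemma degree_le_if_bipoly_le: "bipoly_le D H p \<Longrightarrow> degree p \<le> D"
proof (rule degree_le, intro allI impI)
  fix k assume "bipoly_le D H p" "D < k"
  then have "coeff (coeff p k) l = 0" for l unfolding bipoly_le_def by (meson add_leD1 not_le)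
  then show "coeff p k = 0" by (simp add: poly_eq_iff)
qed

lemma degree_coeff_le_if_bipoly_le: "bipoly_le D H p \<Longrightarrow> degree (coeff p k) \<le> D"
proof (rule degree_le, intro allI impI)
  fix l assume "bipoly_le D H p" "D < l"
  then show "coeff (coeff p k) l = 0" unfolding bipoly_le_def by (meson add_leD2 not_le)
qed

lemma abs_coeff_le_if_bipoly_le: "bipoly_le D H p \<Longrightarrow> \<bar>coeff (coeff p k) l\<bar> \<le> H"
  using coeff_le_coeff_norm[OF subnorm_abs, of "coeff p k" l] coeff_le_coeff_norm[OF subnorm1, of p k]
  unfolding bipoly_le_def by linarith

lemma bipoly_le_pderiv:
  assumes "bipoly_le D H p" shows "bipoly_le D (real D * H) (pderiv p)"
proof -
  have "coeff_norm (coeff_norm abs) (pderiv p) \<le> real D * coeff_norm (coeff_norm abs) p"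
    using degree_le_if_bipoly_le[OF assms] by (intro coeff_norm_pderiv subnorm1)
  also have "\<dots> \<le> real D * H" using assms by (intro mult_left_mono) (auto simp: bipoly_le_def)
  finally have "coeff_norm (coeff_norm abs) (pderiv p) \<le> real D * H" .
  moreover have c: "coeff (coeff (pderiv p) k) l = real (Suc k) * coeff (coeff p (Suc k)) l" for k l
    by (simp add: coeff_pderiv mult_of_nat_commute flip: of_nat_Suc) (simp add: of_nat_poly)
  moreover have "k + l \<le> D" if "coeff (coeff (pderiv p) k) l \<noteq> 0" for k l
  proof -
    have "coeff (coeff p (Suc k)) l \<noteq> 0" using that unfolding c by auto
    then show ?thesis using assms unfolding bipoly_le_def by fastforce
  qed
  moreover have "coeff (coeff (pderiv p) k) l \<in> \<int>" for k l
    unfolding c using assms by (intro Ints_mult) (auto simp: bipoly_le_def)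
  ultimately show ?thesis unfolding bipoly_le_def by blast
qed

lemma bipoly_le_det:
  assumes "B \<in> carrier_mat s s" "\<And>i j. i < s \<Longrightarrow> j < s \<Longrightarrow> bipoly_le D H (B $$ (i, j))"
  shows "bipoly_le (s * D) (fact s * H ^ s) (Determinant.det B)"
proof -
  have "bipoly_le (s * D) (real (card {p. p permutes {0..<s}}) * H ^ s)
      (\<Sum>p\<in>{p. p permutes {0..<s}}. signof p * (\<Prod>i=0..<s. B $$ (i, p i)))"
  proof (rule bipoly_le_sum)
    show "finite {p. p permutes {0..<s}}" by (simp add: finite_permutations)
    fix p assume p: "p \<in> {p. p permutes {0..<s}}"
    have "bipoly_le (card {0..<s} * D) (H ^ card {0..<s}) (\<Prod>i=0..<s. B $$ (i, p i))"
    proof (intro bipoly_le_prod assms(2))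
      fix i assume "i \<in> {0..<s}"
      then show "p i < s" "i < s" using p permutes_in_image[of p "{0..<s}" i] by auto
    qed simp
    then show "bipoly_le (s * D) (H ^ s) (signof p * (\<Prod>i=0..<s. B $$ (i, p i)))"
      by (auto simp: sign_def bipoly_le_uminus)
  qed
  then show ?thesis unfolding det_def'[OF assms(1)] by (simp add: card_permutations)
qed

section \<open>A scalar equation with coefficients bounded uniformly in the parameter\<close>

lemma jet_row_bipoly_le:
  fixes A :: "nat \<Rightarrow> nat \<Rightarrow> real poly poly"
  assumes A: "\<And>p q. bipoly_le d h (A p q)" and G: "real n * (real d + h) \<le> G"
  shows "k \<le> n \<Longrightarrow> bipoly_le (k * d) (G ^ k) (jet_row n A k q)"
proof (induction k arbitrary: q)
  case 0
  show ?case by (simp add: jet_row_0 bipoly_le_0 bipoly_le_1)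
next
  case (Suc k)
  have h0: "h \<ge> 0" using bipoly_le_nonneg[OF A] .
  then have G0: "G \<ge> 0" using G by (meson add_nonneg_nonneg mult_nonneg_nonneg of_nat_0_le_iff order_trans)
  have IH: "bipoly_le (k * d) (G ^ k) (jet_row n A k q)" for q using Suc by simp
  have "bipoly_le (k * d + d) (real (k * d) * G ^ k) (pderiv (jet_row n A k q))"
    using bipoly_le_pderiv[OF IH] by (rule bipoly_le_mono) auto
  moreover have "bipoly_le (k * d + d) (real (card {..<n}) * (G ^ k * h)) (\<Sum>p<n. jet_row n A k p * A p q)"
    by (intro bipoly_le_sum bipoly_le_mult IH A) auto
  ultimately have "bipoly_le (k * d + d) (real (k * d) * G ^ k + real n * (G ^ k * h)) (jet_row n A (Suc k) q)"
    unfolding jet_row_Suc dual_deriv_def using bipoly_le_add by fastforce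
  then show ?case
  proof (rule bipoly_le_mono)
    have "real (k * d) * G ^ k + real n * (G ^ k * h) = (real k * real d + real n * h) * G ^ k"
      by (simp add: algebra_simps)
    also have "\<dots> \<le> (real n * (real d + h)) * G ^ k"
      using Suc.prems G0 by (intro mult_right_mono) (auto simp: algebra_simps intro: mult_left_mono)
    also have "\<dots> \<le> G ^ Suc k" using G G0 by (simp add: mult_right_mono)
    finally show "real (k * d) * G ^ k + real n * (G ^ k * h) \<le> G ^ Suc k" .
  qed simp
qed

lemma jet_row_zero_outside:
  assumes "\<And>p q. n \<le> q \<Longrightarrow> A p q = 0" "n \<ge> 1" "n \<le> q"
  shows "jet_row n A k q = 0"
  using assms by (induction k) (auto simp: jet_row_0 jet_row_Suc dual_deriv_def)

text \<open>
  Cramer's rule for the first dependent row: \<open>r\<close> is the largest number for which the first \<open>r\<close>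
  rows have a nonzero minor of size \<open>r\<close>, and \<open>\<delta>\<close> is such a minor, with columns \<open>\<phi>\<close>. Up to sign the \<open>m\<^sub>j\<close> are the other maximal
  minors of the rows \<open>0, \<dots>, r\<close> in the same columns, and the functionals \<open>Y k\<close> come from the
  adjugate matrix.
\<close>

lemma jet_row_relation:
  fixes A :: "nat \<Rightarrow> nat \<Rightarrow> real poly poly"
  assumes A: "\<And>p q. bipoly_le d h (A p q)" and out: "\<And>p q. n \<le> q \<Longrightarrow> A p q = 0"
    and G: "real n * (real d + h) \<le> G" "1 \<le> G" and n: "n \<ge> 1"
  shows "\<exists>r \<phi> \<delta> m Y. 1 \<le> r \<and> r \<le> n \<and> \<delta> \<noteq> 0 \<and>
     (\<forall>q. \<delta> * jet_row n A r q = (\<Sum>j<r. m j * jet_row n A j q)) \<and>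
     (\<forall>i<r. \<forall>k<r. (\<Sum>j<r. Y k j * jet_row n A i (\<phi> j)) = (if i = k then \<delta> else 0)) \<and>
     bipoly_le (n * n * d) (fact n * G ^ (n * n)) \<delta> \<and>
     (\<forall>j<r. bipoly_le (n * n * d) (fact n * G ^ (n * n)) (m j))"
proof -
  let ?c = "jet_row n A"
  define B where "B s \<phi> = Matrix.mat s s (\<lambda>(i, j). ?c i (\<phi> j))" for s and \<phi> :: "nat \<Rightarrow> nat"
  define Q where "Q s \<longleftrightarrow> (\<exists>\<phi>. (\<forall>j<s. \<phi> j < n) \<and> Determinant.det (B s \<phi>) \<noteq> 0)" for s
  have "Q 1"
    unfolding Q_def using n
    by (intro exI[of _ "\<lambda>_. 0"]) (auto simp: B_def det_single jet_row_0)
  moreover have Qn: "s \<le> n" if "Q s" for s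
  proof (rule ccontr)
    assume "\<not> s \<le> n"
    obtain \<phi> where \<phi>: "\<And>j. j < s \<Longrightarrow> \<phi> j < n" "Determinant.det (B s \<phi>) \<noteq> 0"
      using \<open>Q s\<close> by (auto simp: Q_def)
    have "\<not> inj_on \<phi> {..<s}"
      using card_inj_on_le[of \<phi> "{..<s}" "{..<n}"] \<phi>(1) \<open>\<not> s \<le> n\<close> by auto
    then obtain i j where ij: "i < s" "j < s" "i \<noteq> j" "\<phi> i = \<phi> j" by (auto simp: inj_on_def)
    have "Determinant.det (B s \<phi>) = 0"
      by (rule Determinant.det_identical_columns[of _ s i j]) (use ij in \<open>auto simp: B_def col_def\<close>)
    then show False using \<phi>(2) by simp
  qed
  ultimately obtain r where r: "Q r" "\<And>s. Q s \<Longrightarrow> s \<le> r"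
    using ex_has_greatest_nat[of Q 1 "\<lambda>s. s" "Suc n"] by (auto simp: less_Suc_eq_le)
  have r1: "1 \<le> r" "r \<le> n" using r \<open>Q 1\<close> Qn by auto
  obtain \<phi> where \<phi>: "\<And>j. j < r \<Longrightarrow> \<phi> j < n" "Determinant.det (B r \<phi>) \<noteq> 0"
    using r(1) by (auto simp: Q_def)
  have cb: "bipoly_le (n * d) (G ^ n) (?c k q)" if "k \<le> n" for k q
    using jet_row_bipoly_le[OF A G(1) that]
    by (rule bipoly_le_mono) (use that G(2) in \<open>auto intro: power_increasing mult_right_mono\<close>)
  define X where "X i = Matrix.mat r r (\<lambda>(i', j). ?c (if i' < i then i' else Suc i') (\<phi> j))" for i
  have Xb: "bipoly_le (n * n * d) (fact n * G ^ (n * n)) (Determinant.det (X i))" for i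
  proof -
    have "bipoly_le (r * (n * d)) (fact r * (G ^ n) ^ r) (Determinant.det (X i))"
    proof (rule bipoly_le_det)
      fix i' j assume "i' < r" "j < r"
      then have "(if i' < i then i' else Suc i') \<le> n" using r1 by auto
      then show "bipoly_le (n * d) (G ^ n) (X i $$ (i', j))"
        using cb \<open>i' < r\<close> \<open>j < r\<close> by (simp add: X_def)
    qed (simp add: X_def)
    then show ?thesis
    proof (rule bipoly_le_mono)
      show "r * (n * d) \<le> n * n * d" using r1 by (simp add: mult.assoc)
      have "fact r * (G ^ n) ^ r \<le> fact n * (G ^ n) ^ n"
        using r1 G(2) by (intro mult_mono power_increasing fact_mono one_le_power) auto
      then show "fact r * (G ^ n) ^ r \<le> fact n * G ^ (n * n)" by (simp add: power_mult)
    qed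
  qed
  have XB: "X r = B r \<phi>" by (rule eq_matI) (auto simp: X_def B_def)
  define m where "m i = - ((-1) ^ (i + r) * Determinant.det (X i))" for i
  have mb: "bipoly_le (n * n * d) (fact n * G ^ (n * n)) (m j)" for j
    unfolding m_def using Xb[of j] by (cases "even (j + r)") (auto intro: bipoly_le_uminus)
  \<comment> \<open>bordered minors vanish by the choice of r; expand along the added column\<close>
  have rel: "Determinant.det (B r \<phi>) * ?c r q = (\<Sum>j<r. m j * ?c j q)" for q
  proof (cases "q < n")
    case True
    define \<phi>' where "\<phi>' j = (if j < r then \<phi> j else q)" for j
    have "\<not> Q (Suc r)" using r(2)[of "Suc r"] by auto
    then have det0: "Determinant.det (B (Suc r) \<phi>') = 0"
      using \<phi>(1) True unfolding Q_def by (metis \<phi>'_def)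
    have del: "mat_delete (B (Suc r) \<phi>') i r = X i" for i
      by (rule eq_matI) (auto simp: mat_delete_def B_def X_def \<phi>'_def)
    have "0 = (\<Sum>i<Suc r. B (Suc r) \<phi>' $$ (i, r) * cofactor (B (Suc r) \<phi>') i r)"
      using laplace_expansion_column[of "B (Suc r) \<phi>'" "Suc r" r] det0 by (simp add: B_def)
    also have "\<dots> = (\<Sum>i<Suc r. ?c i q * ((-1) ^ (i + r) * Determinant.det (X i)))"
      unfolding cofactor_def del by (intro sum.cong) (auto simp: B_def \<phi>'_def)
    also have "\<dots> = (\<Sum>i<r. ?c i q * ((-1) ^ (i + r) * Determinant.det (X i))) + Determinant.det (B r \<phi>) * ?c r q"
      by (simp add: XB mult.commute flip: mult_2)
    finally show ?thesis by (simp add: m_def sum_negf mult.commute eq_neg_iff_add_eq_0 add.commute)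
  next
    case False
    then show ?thesis using jet_row_zero_outside[of n A q] out n by simp
  qed
  define Y where "Y k j = adj_mat (B r \<phi>) $$ (j, k)" for k j
  have Bc: "B r \<phi> \<in> carrier_mat r r" by (simp add: B_def)
  have dual: "(\<Sum>j<r. Y k j * ?c i (\<phi> j)) = (if i = k then Determinant.det (B r \<phi>) else 0)" if "i < r" "k < r" for i k
  proof -
    have "(B r \<phi> * adj_mat (B r \<phi>)) $$ (i, k) = (\<Sum>j<r. Y k j * ?c i (\<phi> j))"
      using that adj_mat(1)[OF Bc] Bc
      by (simp add: scalar_prod_def Y_def B_def mult.commute lessThan_atLeast0)
    then show ?thesis unfolding adj_mat(2)[OF Bc] using that by (cases "i = k") simp_all
  qed
  show ?thesis
    using r1 \<phi>(2) rel dual Xb[of r] mb unfolding XB by blast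
qed

text \<open>
  Comparing coefficients turns an ideal membership of bounded degree into a linear system over the
  integers, of which \<open>exists_bounded_solution\<close> supplies a solution of controlled size.
\<close>

lemma bounded_bezout:
  fixes a :: "nat \<Rightarrow> real poly"
  assumes a: "\<And>i. i \<le> D \<Longrightarrow> degree (a i) \<le> D" "\<And>i l. i \<le> D \<Longrightarrow> coeff (a i) l \<in> \<int> \<and> \<bar>coeff (a i) l\<bar> \<le> H"
    and b: "degree b \<le> D" "\<And>l. coeff b l \<in> \<int> \<and> \<bar>coeff b l\<bar> \<le> H"
    and u: "b = (\<Sum>i\<le>D. u i * a i)" and H: "H \<ge> 1"
  defines "N \<equiv> (D + 1) * (2 * D + 1)"
  shows "\<exists>v. b = (\<Sum>i\<le>D. v i * a i) \<and>
    (\<forall>i\<le>D. \<forall>x. \<bar>poly (v i) x\<bar> \<le> real (2 * D + 1) * (real N * (real (3 * D + 1) * H\<^sup>2)) ^ N * (max 1 \<bar>x\<bar>) ^ (2 * D))"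
proof (cases "\<exists>k\<le>D. a k \<noteq> 0")
  case False
  then have "b = (\<Sum>i\<le>D. 0 * a i)" using u by simp
  then show ?thesis using H by (intro exI[of _ "\<lambda>_. 0"]) auto
next
  case True
  then obtain k where "k \<le> D" "a k \<noteq> 0" by blast
  from bezout_degree_reduction[OF a(1) this b(1) u]
  obtain v where v: "b = (\<Sum>i\<le>D. v i * a i)" "\<And>i. i \<le> D \<Longrightarrow> degree (v i) \<le> 2 * D" by blast
  define J where "J = {..D} \<times> {..2 * D}"
  define c where "c e j = (if snd j \<le> e then coeff (a (fst j)) (e - snd j) else 0)" for e :: nat and j :: "nat \<times> nat"
  have cf: "coeff (\<Sum>i\<le>D. w i * a i) e = (\<Sum>j\<in>J. c e j * coeff (w (fst j)) (snd j))"
    if w: "\<And>i. i \<le> D \<Longrightarrow> degree (w i) \<le> 2 * D" for w e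
  proof -
    have "coeff (w i * a i) e = (\<Sum>l\<le>2 * D. c e (i, l) * coeff (w i) l)" if i: "i \<le> D" for i
    proof -
      have "coeff (w i * a i) e = (\<Sum>l\<in>{..e}. c e (i, l) * coeff (w i) l)"
        unfolding coeff_mult by (intro sum.cong) (auto simp: c_def)
      also have "\<dots> = (\<Sum>l\<in>{..max e (2 * D)}. c e (i, l) * coeff (w i) l)"
        by (intro sum.mono_neutral_left) (auto simp: c_def)
      also have "\<dots> = (\<Sum>l\<in>{..2 * D}. c e (i, l) * coeff (w i) l)"
        using w[OF i] by (intro sum.mono_neutral_right) (auto simp: coeff_eq_0)
      finally show ?thesis .
    qed
    then have "coeff (\<Sum>i\<le>D. w i * a i) e = (\<Sum>i\<le>D. \<Sum>l\<le>2 * D. c e (i, l) * coeff (w i) l)"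
      by (simp add: coeff_sum)
    then show ?thesis by (simp add: J_def sum.cartesian_product case_prod_beta)
  qed
  have cJ: "card J = N" by (simp add: J_def N_def)
  have "\<exists>u. (\<forall>e\<in>{..3 * D}. (\<Sum>j\<in>J. c e j * u j) = coeff b e) \<and>
     (\<forall>j\<in>J. \<bar>u j\<bar> \<le> (real (card J) * (real (card {..3 * D}) * H\<^sup>2)) ^ card J)"
  proof (rule exists_bounded_solution[where ?u0.0 = "\<lambda>j. coeff (v (fst j)) (snd j)"])
    show "c e j \<in> \<int> \<and> \<bar>c e j\<bar> \<le> H" if "j \<in> J" for e j
      using a(2)[of "fst j"] that H by (auto simp: c_def J_def)
    show "(\<Sum>j\<in>J. c e j * coeff (v (fst j)) (snd j)) = coeff b e" for e
      using cf[of v e] v by simp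
  qed (use b H in \<open>auto simp: J_def\<close>)
  then obtain y where y: "\<And>e. e \<le> 3 * D \<Longrightarrow> (\<Sum>j\<in>J. c e j * y j) = coeff b e"
    "\<And>j. j \<in> J \<Longrightarrow> \<bar>y j\<bar> \<le> (real N * (real (3 * D + 1) * H\<^sup>2)) ^ N"
    unfolding cJ by auto
  let ?U = "(real N * (real (3 * D + 1) * H\<^sup>2)) ^ N"
  define w where "w i = (\<Sum>l\<le>2 * D. monom (y (i, l)) l)" for i
  have cw: "coeff (w i) l = (if l \<le> 2 * D then y (i, l) else 0)" for i l
    by (simp add: w_def coeff_sum)
  have dw: "degree (w i) \<le> 2 * D" for i by (rule degree_le) (simp add: cw)
  have "b = (\<Sum>i\<le>D. w i * a i)"
  proof (rule poly_eqI)
    fix e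
    show "coeff b e = coeff (\<Sum>i\<le>D. w i * a i) e"
    proof (cases "e \<le> 3 * D")
      case True
      have "(\<Sum>j\<in>J. c e j * coeff (w (fst j)) (snd j)) = (\<Sum>j\<in>J. c e j * y j)"
        by (intro sum.cong) (auto simp: cw J_def)
      then show ?thesis using cf[of w e] dw y(1)[OF True] by simp
    next
      case False
      have "degree (\<Sum>i\<le>D. w i * a i) \<le> 3 * D"
      proof (rule degree_sum_le)
        fix i assume "i \<in> {..D}"
        then show "degree (w i * a i) \<le> 3 * D"
          using degree_mult_le[of "w i" "a i"] dw[of i] a(1)[of i] by simp
      qed simp
      then show ?thesis using False b(1) by (simp add: coeff_eq_0)
    qed
  qed
  moreover have "\<bar>poly (w i) x\<bar> \<le> real (2 * D + 1) * ?U * (max 1 \<bar>x\<bar>) ^ (2 * D)" if i: "i \<le> D" for i x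
  proof -
    have "\<bar>poly (w i) x\<bar> = \<bar>\<Sum>l\<le>2 * D. y (i, l) * x ^ l\<bar>"
      by (simp add: w_def poly_sum poly_monom)
    also have "\<dots> \<le> (\<Sum>l\<le>2 * D. ?U * (max 1 \<bar>x\<bar>) ^ (2 * D))"
    proof (intro order_trans[OF sum_abs] sum_mono)
      fix l assume l: "l \<in> {..2 * D}"
      have "\<bar>x\<bar> ^ l \<le> (max 1 \<bar>x\<bar>) ^ l" by (intro power_mono) auto
      also have "\<dots> \<le> (max 1 \<bar>x\<bar>) ^ (2 * D)" using l by (intro power_increasing) auto
      finally show "\<bar>y (i, l) * x ^ l\<bar> \<le> ?U * (max 1 \<bar>x\<bar>) ^ (2 * D)"
        using y(2)[of "(i, l)"] i l by (auto simp: abs_mult power_abs J_def intro!: mult_mono)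
    qed
    finally show ?thesis by simp
  qed
  ultimately show ?thesis by blast
qed

text \<open>
  The relation of \<open>jet_row_relation\<close> has coefficients of bounded height, but \<open>\<delta>\<close> may vanish
  identically in \<open>t\<close> at some parameter values; removing the common factor \<open>h\<close> repairs this, though it may
  destroy integrality. The membership of the coefficients of \<open>m\<^sub>j\<close> in the ideal generated by those of \<open>\<delta>\<close>
  is therefore solved over the integers before the removal, and its solution is used after it.
\<close>

lemma uniform_scalar_equation:
  fixes A :: "nat \<Rightarrow> nat \<Rightarrow> real poly poly"
  assumes A: "\<And>p q. bipoly_le d h (A p q)" and out: "\<forall>p. \<forall>q\<ge>n. A p q = 0"
    and G: "real n * (real d + h) \<le> G" "1 \<le> G" and n: "n \<ge> 1"
  defines "D \<equiv> n * n * d" and "H \<equiv> fact n * G ^ (n * n)"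
  defines "N \<equiv> (D + 1) * (2 * D + 1)"
  defines "\<Lambda> \<equiv> \<lambda>x::real. real (D + 1) * (real (2 * D + 1) * (real N * (real (3 * D + 1) * H\<^sup>2)) ^ N * (max 1 \<bar>x\<bar>) ^ (2 * D))"
  shows "\<exists>r \<delta> m. 1 \<le> r \<and> r \<le> n \<and> degree \<delta> \<le> D \<and> (\<forall>j<r. degree (m j) \<le> D) \<and>
     (\<forall>q. \<delta> * jet_row n A r q = (\<Sum>j<r. m j * jet_row n A j q)) \<and>
     (\<forall>x. (\<exists>k. poly (coeff \<delta> k) x \<noteq> 0) \<and>
       (\<forall>j<r. \<forall>k. \<exists>i. \<bar>poly (coeff (m j) k) x\<bar> \<le> \<Lambda> x * \<bar>poly (coeff \<delta> i) x\<bar>))"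
proof -
  let ?c = "jet_row n A"
  obtain r \<phi> \<delta> m Y where r: "1 \<le> r" "r \<le> n" and \<delta>0: "\<delta> \<noteq> 0"
    and rel: "\<And>q. \<delta> * ?c r q = (\<Sum>j<r. m j * ?c j q)"
    and dual: "\<And>i k. i < r \<Longrightarrow> k < r \<Longrightarrow> (\<Sum>j<r. Y k j * ?c i (\<phi> j)) = (if i = k then \<delta> else 0)"
    and \<delta>b: "bipoly_le D H \<delta>" and mb: "\<And>j. j < r \<Longrightarrow> bipoly_le D H (m j)"
    using jet_row_relation[of d h A n G] A out G n unfolding D_def H_def by blast
  have H1: "H \<ge> 1" using mult_mono[of 1 "fact n :: real" 1 "G ^ (n * n)"] one_le_power[OF G(2), of "n * n"]
    by (simp add: H_def)
  obtain h \<delta>' m' where h: "h \<noteq> 0" "\<delta> = [:h:] * \<delta>'" "\<And>j. j < r \<Longrightarrow> m j = [:h:] * m' j"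
    and min: "\<And>p. prime_elem p \<Longrightarrow> [:p:] dvd \<delta>' \<Longrightarrow> \<exists>j<r. \<not> [:p:] dvd m' j"
    using split_off_common_factor[OF \<delta>0, of r m] by blast
  have rel': "\<delta>' * ?c r q = (\<Sum>j<r. m' j * ?c j q)" for q
  proof -
    have "[:h:] * (\<delta>' * ?c r q) = \<delta> * ?c r q" unfolding h(2) by (simp only: mult.assoc)
    also have "\<dots> = (\<Sum>j<r. [:h:] * (m' j * ?c j q))"
      unfolding rel by (intro sum.cong refl) (simp only: h(3) lessThan_iff mult.assoc)
    also have "\<dots> = [:h:] * (\<Sum>j<r. m' j * ?c j q)" by (simp only: sum_distrib_left)
    finally show ?thesis using h(1) by (metis mult_cancel_left pCons_eq_0_iff)
  qed
  have \<delta>'0: "\<delta>' \<noteq> 0" using \<delta>0 h(2) by auto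
  have prim: "\<not> [:p:] dvd \<delta>'" if "prime_elem p" for p
  proof
    assume "[:p:] dvd \<delta>'"
    with min[OF that] obtain s where "s < r" "\<not> [:p:] dvd m' s" by blast
    then show False
      using cyclic_leading_coeff[OF that rel' \<open>[:p:] dvd \<delta>'\<close> _ _ dual \<delta>0] by blast
  qed
  have ch: "coeff \<delta> k = h * coeff \<delta>' k" for k by (simp add: h(2))
  have cm: "coeff (m j) k = h * coeff (m' j) k" if "j < r" for j k by (simp add: h(3)[OF that])
  have d\<delta>: "degree \<delta>' \<le> D"
    using degree_le_if_bipoly_le[OF \<delta>b] h(1) by (simp add: h(2))
  have dm: "degree (m' j) \<le> D" if "j < r" for j
    using degree_le_if_bipoly_le[OF mb[OF that]] h(1) by (simp add: h(3)[OF that])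
  obtain u where u: "(\<Sum>i\<le>degree \<delta>'. u i * coeff \<delta>' i) = 1"
    using primitive_bezout[OF prim \<delta>'0] by blast
  have u': "(\<Sum>i\<le>D. u i * coeff \<delta>' i) = 1"
    unfolding u[symmetric] using d\<delta> by (intro sum.mono_neutral_right) (auto simp: coeff_eq_0)
  have nz: "\<exists>k. poly (coeff \<delta>' k) x \<noteq> 0" for x
  proof (rule ccontr)
    assume "\<not> ?thesis"
    then have "poly (\<Sum>i\<le>D. u i * coeff \<delta>' i) x = 0" by (simp add: poly_sum)
    then show False unfolding u' by simp
  qed
  have bd: "\<exists>i. \<bar>poly (coeff (m' j) k) x\<bar> \<le> \<Lambda> x * \<bar>poly (coeff \<delta>' i) x\<bar>" if j: "j < r" for j k x
  proof -
    have "\<exists>v. coeff (m j) k = (\<Sum>i\<le>D. v i * coeff \<delta> i) \<and> (\<forall>i\<le>D. \<forall>x. \<bar>poly (v i) x\<bar>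
        \<le> real (2 * D + 1) * (real N * (real (3 * D + 1) * H\<^sup>2)) ^ N * (max 1 \<bar>x\<bar>) ^ (2 * D))"
      unfolding N_def
    proof (rule bounded_bezout[OF _ _ _ _ _ H1])
      show "degree (coeff \<delta> i) \<le> D" for i by (rule degree_coeff_le_if_bipoly_le[OF \<delta>b])
      show "degree (coeff (m j) k) \<le> D" by (rule degree_coeff_le_if_bipoly_le[OF mb[OF j]])
      show "coeff (coeff \<delta> i) l \<in> \<int> \<and> \<bar>coeff (coeff \<delta> i) l\<bar> \<le> H" for i l
        using abs_coeff_le_if_bipoly_le[OF \<delta>b] \<delta>b by (simp add: bipoly_le_def)
      show "coeff (coeff (m j) k) l \<in> \<int> \<and> \<bar>coeff (coeff (m j) k) l\<bar> \<le> H" for l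
        using abs_coeff_le_if_bipoly_le[OF mb[OF j]] mb[OF j] by (simp add: bipoly_le_def)
      have "coeff (m j) k = h * coeff (m' j) k * (\<Sum>i\<le>D. u i * coeff \<delta>' i)" using cm[OF j] u' by simp
      then show "coeff (m j) k = (\<Sum>i\<le>D. (u i * coeff (m' j) k) * coeff \<delta> i)"
        unfolding ch by (simp add: sum_distrib_left mult_ac)
    qed
    then obtain v where v: "coeff (m j) k = (\<Sum>i\<le>D. v i * coeff \<delta> i)"
      "\<And>i x. i \<le> D \<Longrightarrow> \<bar>poly (v i) x\<bar> \<le> real (2 * D + 1) * (real N * (real (3 * D + 1) * H\<^sup>2)) ^ N * (max 1 \<bar>x\<bar>) ^ (2 * D)"
      by blast
    have "h * coeff (m' j) k = h * (\<Sum>i\<le>D. v i * coeff \<delta>' i)"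
      using v(1) unfolding cm[OF j] ch by (simp add: sum_distrib_left mult_ac)
    then have v': "coeff (m' j) k = (\<Sum>i\<le>D. v i * coeff \<delta>' i)" using h(1) by simp
    let ?V = "real (2 * D + 1) * (real N * (real (3 * D + 1) * H\<^sup>2)) ^ N * (max 1 \<bar>x\<bar>) ^ (2 * D)"
    have V0: "0 \<le> ?V" using v(2)[of 0 x] abs_ge_zero order_trans by blast
    obtain i where i: "i \<le> D" "\<And>i'. i' \<le> D \<Longrightarrow> \<bar>poly (coeff \<delta>' i') x\<bar> \<le> \<bar>poly (coeff \<delta>' i) x\<bar>"
    proof -
      let ?g = "\<lambda>i. \<bar>poly (coeff \<delta>' i) x\<bar>"
      have "Max (?g ` {..D}) \<in> ?g ` {..D}" by (rule Max_in) auto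
      then obtain i where i: "i \<in> {..D}" "Max (?g ` {..D}) = ?g i" unfolding image_iff by blast
      have "?g i' \<le> ?g i" if "i' \<le> D" for i'
        unfolding i(2)[symmetric] using that by (intro Max_ge) auto
      then show ?thesis using that[of i] i(1) by auto
    qed
    have "\<bar>poly (coeff (m' j) k) x\<bar> = \<bar>\<Sum>i\<le>D. poly (v i) x * poly (coeff \<delta>' i) x\<bar>"
      unfolding v' by (simp add: poly_sum)
    also have "\<dots> \<le> (\<Sum>i'\<le>D. ?V * \<bar>poly (coeff \<delta>' i) x\<bar>)"
      using v(2) i V0 by (intro order_trans[OF sum_abs] sum_mono) (auto simp: abs_mult intro!: mult_mono)
    also have "\<dots> = \<Lambda> x * \<bar>poly (coeff \<delta>' i) x\<bar>" unfolding \<Lambda>_def by simp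
    finally show ?thesis by blast
  qed
  show ?thesis using r d\<delta> dm rel' nz bd by blast
qed

section \<open>Specialization of the parameter\<close>

definition specialize :: "real \<Rightarrow> real poly poly \<Rightarrow> complex poly" where
  "specialize \<epsilon> p = map_poly (\<lambda>q. complex_of_real (poly q \<epsilon>)) p"

lemma coeff_specialize: "coeff (specialize \<epsilon> p) k = complex_of_real (poly (coeff p k) \<epsilon>)"
  by (simp add: specialize_def coeff_map_poly)

lemma specialize_0: "specialize \<epsilon> 0 = 0"
  by (simp add: specialize_def)

lemma specialize_1: "specialize \<epsilon> 1 = 1"
  by (rule poly_eqI) (simp add: coeff_specialize coeff_1 split: if_splits)

lemma specialize_add: "specialize \<epsilon> (p + q) = specialize \<epsilon> p + specialize \<epsilon> q"
  by (rule poly_eqI) (simp add: coeff_specialize)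

lemma specialize_mult: "specialize \<epsilon> (p * q) = specialize \<epsilon> p * specialize \<epsilon> q"
  by (rule poly_eqI) (simp add: coeff_specialize coeff_mult poly_sum)

lemma specialize_sum: "specialize \<epsilon> (\<Sum>i\<in>I. f i) = (\<Sum>i\<in>I. specialize \<epsilon> (f i))"
  by (induction I rule: infinite_finite_induct) (auto simp: specialize_0 specialize_add)

lemma specialize_pderiv: "specialize \<epsilon> (pderiv p) = pderiv (specialize \<epsilon> p)"
  by (rule poly_eqI) (simp add: coeff_specialize coeff_pderiv)

lemma degree_specialize_le: "degree (specialize \<epsilon> p) \<le> degree p"
  by (rule degree_le) (simp add: coeff_specialize coeff_eq_0)

definition real_system :: "nat \<Rightarrow> int poly poly mat \<Rightarrow> nat \<Rightarrow> nat \<Rightarrow> real poly poly" where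
  "real_system n A p q = (if p < n \<and> q < n then map_poly (map_poly of_int) (A $$ (p, q)) else 0)"

lemma coeff_real_system:
  "p < n \<Longrightarrow> q < n \<Longrightarrow> coeff (coeff (real_system n A p q) k) l = of_int (coeff (coeff (A $$ (p, q)) k) l)"
  by (simp add: real_system_def coeff_map_poly)

lemma eval2_eq_specialize:
  assumes "p < n" "q < n"
  shows "eval2 (A $$ (p, q)) t (complex_of_real \<epsilon>) = poly (specialize \<epsilon> (real_system n A p q)) t"
proof -
  have "poly (map_poly of_int c) (complex_of_real \<epsilon>) = complex_of_real (poly (map_poly of_int c) \<epsilon>)" for c
    by (simp add: poly_map_poly_altdef)
  then have "map_poly (\<lambda>c. poly (map_poly of_int c) (complex_of_real \<epsilon>)) (A $$ (p, q))
      = specialize \<epsilon> (real_system n A p q)"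
    using assms by (intro poly_eqI) (simp add: coeff_specialize coeff_map_poly real_system_def)
  then show ?thesis by (simp add: eval2_def)
qed

lemma real_system_bipoly_le:
  assumes "\<forall>i<n. \<forall>j<n. total_degree (A $$ (i, j)) \<le> d \<and> height_le (A $$ (i, j)) M"
  shows "bipoly_le d (real M * (real d + 1)\<^sup>2) (real_system n A p q)"
proof (cases "p < n \<and> q < n")
  case True
  note c = coeff_real_system[of p n q A]
  let ?P = "real_system n A p q"
  have deg: "k + l \<le> d" if "coeff (coeff ?P k) l \<noteq> 0" for k l
    using that True assms by (auto simp: c total_degree_le_iff)
  have hgt: "\<bar>coeff (coeff ?P k) l\<bar> \<le> real M" for k l
  proof -
    have "\<bar>coeff (coeff (A $$ (p, q)) k) l\<bar> \<le> int M" using True assms by (auto simp: height_le_def)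
    then have "real_of_int \<bar>coeff (coeff (A $$ (p, q)) k) l\<bar> \<le> real_of_int (int M)" by (simp only: of_int_le_iff)
    then show ?thesis using True by (simp add: c)
  qed
  have d1: "degree (coeff ?P k) \<le> d" for k
    by (rule degree_le) (meson add_leD2 deg not_le)
  have d2: "degree ?P \<le> d"
  proof (rule degree_le, intro allI impI poly_eqI)
    fix k l assume "d < k"
    then show "coeff (coeff ?P k) l = coeff 0 l" using deg[of k l] by (metis add_leD1 coeff_0 not_le)
  qed
  have "coeff_norm (coeff_norm abs) ?P = (\<Sum>k\<le>d. \<Sum>l\<le>d. \<bar>coeff (coeff ?P k) l\<bar>)"
    by (simp add: coeff_norm_eq[OF subnorm1 d2] coeff_norm_eq[OF subnorm_abs d1])
  also have "\<dots> \<le> (\<Sum>k\<le>d. \<Sum>l\<le>d. real M)" using hgt by (intro sum_mono)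
  also have "\<dots> = real M * (real d + 1)\<^sup>2" by (simp add: power2_eq_square add.commute)
  finally show ?thesis using deg True by (auto simp: bipoly_le_def c)
next
  case False
  then have "real_system n A p q = 0" by (auto simp: real_system_def)
  then show ?thesis by (simp add: bipoly_le_0)
qed

lemma solution_higher_deriv:
  fixes x :: "complex \<Rightarrow> complex Matrix.vec"
  assumes sol: "holomorphic_solution n A (complex_of_real \<epsilon>) x" and A: "A \<in> carrier_mat n n" and n: "n \<ge> 1"
  shows "((deriv ^^ k) (\<lambda>t. x t $ 0)) t
       = (\<Sum>q<n. poly (specialize \<epsilon> (jet_row n (real_system n A) k q)) t * x t $ q)"
proof (induction k arbitrary: t)
  case 0
  have "(\<Sum>q<n. poly (specialize \<epsilon> (jet_row n (real_system n A) 0 q)) t * x t $ q) = (\<Sum>q<n. if q = 0 then x t $ q else 0)"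
    by (intro sum.cong) (auto simp: jet_row_0 specialize_0 specialize_1)
  then show ?case using n by simp
next
  case (Suc k)
  let ?c = "\<lambda>k q. specialize \<epsilon> (jet_row n (real_system n A) k q)"
  let ?a = "\<lambda>p q. poly (specialize \<epsilon> (real_system n A p q)) t"
  have xd: "((\<lambda>s. x s $ i) has_field_derivative (\<Sum>j<n. ?a i j * x t $ j)) (at t)" if i: "i < n" for i
  proof -
    have xt: "x t \<in> carrier_vec n" using sol by (simp add: holomorphic_solution_def)
    then have "(map_mat (\<lambda>p. eval2 p t (complex_of_real \<epsilon>)) A *\<^sub>v x t) $ i = (\<Sum>j<n. ?a i j * x t $ j)"
      using i A by (auto simp: scalar_prod_def eval2_eq_specialize lessThan_atLeast0 intro!: sum.cong)
    then show ?thesis using sol i unfolding holomorphic_solution_def by metis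
  qed
  have "((\<lambda>t. \<Sum>q<n. poly (?c k q) t * x t $ q) has_field_derivative
      (\<Sum>q<n. poly (pderiv (?c k q)) t * x t $ q + (\<Sum>j<n. ?a q j * x t $ j) * poly (?c k q) t)) (at t)"
    by (intro DERIV_sum DERIV_mult poly_DERIV xd) auto
  moreover have "(\<Sum>q<n. poly (pderiv (?c k q)) t * x t $ q + (\<Sum>j<n. ?a q j * x t $ j) * poly (?c k q) t)
     = (\<Sum>q<n. poly (?c (Suc k) q) t * x t $ q)"
  proof -
    have "(\<Sum>q<n. (\<Sum>j<n. ?a q j * x t $ j) * poly (?c k q) t)
        = (\<Sum>j<n. (\<Sum>q<n. poly (?c k q) t * ?a q j) * x t $ j)"
    proof -
      have "(\<Sum>q<n. (\<Sum>j<n. ?a q j * x t $ j) * poly (?c k q) t)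
          = (\<Sum>q<n. \<Sum>j<n. poly (?c k q) t * ?a q j * x t $ j)"
        unfolding sum_distrib_right by (simp only: mult_ac)
      also have "\<dots> = (\<Sum>j<n. \<Sum>q<n. poly (?c k q) t * ?a q j * x t $ j)" by (rule sum.swap)
      finally show ?thesis by (simp add: sum_distrib_right)
    qed
    then show ?thesis
      by (simp add: jet_row_Suc dual_deriv_def specialize_add specialize_sum specialize_mult
          specialize_pderiv poly_sum sum.distrib distrib_right)
  qed
  ultimately have "((\<lambda>t. \<Sum>q<n. poly (?c k q) t * x t $ q) has_field_derivative
      (\<Sum>q<n. poly (?c (Suc k) q) t * x t $ q)) (at t)" by simp
  moreover have "(deriv ^^ k) (\<lambda>t. x t $ 0) = (\<lambda>t. \<Sum>q<n. poly (?c k q) t * x t $ q)"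
    using Suc.IH by auto
  ultimately show ?case by (simp add: DERIV_imp_deriv)
qed

section \<open>The number of zeros\<close>

lemma monomial_le:
  fixes a b L :: real
  assumes "1 \<le> a" "1 \<le> b" "1 \<le> L" "i \<le> i'" "j \<le> j'" "k \<le> k'"
  shows "a ^ i * b ^ j * L ^ k \<le> a ^ i' * b ^ j' * L ^ k'"
  using assms by (intro mult_mono power_increasing) auto

lemma le_exp_minus_one: "(y::real) \<le> exp (y - 1)"
  using exp_ge_add_one_self[of "y - 1"] by simp

text \<open>
  Everything that depends on \<open>n\<close>, \<open>d\<close> and \<open>M\<close> only is estimated by a power of
  \<open>exp W\<close> with \<open>W = n\<^sup>9 d\<^sup>4 ln (M e)\<close>. The dominant term comes from the \<open>N\<close>-th power in \<open>\<Lambda>\<close>: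
  here \<open>N\<close> is of order \<open>n\<^sup>4 d\<^sup>2\<close> and \<open>ln H\<close> of order \<open>Y = n\<^sup>3 d ln (M e)\<close>. The exponents
  \<open>2 D\<close> of \<open>E\<close> and \<open>2 D + 1\<close> of \<open>R\<close> are absorbed by the outer exponent \<open>4\<close>.
\<close>

lemma explicit_bound_le:
  fixes n d M :: nat and R E x :: real
  assumes n: "n \<ge> 1" and d: "d \<ge> 1" and M: "M \<ge> 1" and R: "R \<ge> 2" and E: "E > 0" "\<bar>x\<bar> \<le> E"
  defines "G \<equiv> 5 * real n * real M * (real d)\<^sup>2"
  defines "D \<equiv> n * n * d" and "H \<equiv> fact n * G ^ (n * n)"
  defines "N \<equiv> (D + 1) * (2 * D + 1)"
  defines "\<Lambda> \<equiv> real (D + 1) * (real (2 * D + 1) * (real N * (real (3 * D + 1) * H\<^sup>2)) ^ N * (max 1 \<bar>x\<bar>) ^ (2 * D))"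
  shows "3 * (40 * R * real n * (1 + (real D + 1) * \<Lambda> * (60 * (real D + 1) * R\<^sup>2) ^ D) + ln (real n * fact n))
    \<le> ((real M * exp 1) powr (166 * real n ^ 9 * real d ^ 4) * (E ^ (n * (n + 1) * d) + 1)
           * R powr (real (n * (n + 1) * d) / 2 + 1) + real n) powr 4"
proof -
  define a b L where "a = real n" and "b = real d" and "L = 1 + ln (real M)"
  have a1: "a \<ge> 1" and b1: "b \<ge> 1" and L1: "L \<ge> 1" using n d M by (auto simp: a_def b_def L_def)
  note mono = monomial_le[OF a1 b1 L1]
  have Mexp: "real M = exp (L - 1)" using M by (simp add: L_def)
  have Dr: "real D = a\<^sup>2 * b" by (simp add: D_def a_def b_def power2_eq_square)
  have D1: "real D \<ge> 1" using mono[of 0 2 0 1 0 0] by (simp add: Dr)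
  define Y W where "Y = a ^ 3 * b * L" and "W = a ^ 9 * b ^ 4 * L"
  have Y: "a \<le> Y" "b \<le> Y" "1 \<le> Y" "a\<^sup>2 \<le> Y"
    using mono[of 1 3 0 1 0 1] mono[of 0 3 1 1 0 1] mono[of 0 3 0 1 0 1] mono[of 2 3 0 1 0 1]
    by (auto simp: Y_def)
  have YW: "6 * a ^ 4 * b ^ 2 * Y \<le> 6 * W"
  proof -
    have "a ^ 4 * b ^ 2 * Y = a ^ 7 * b ^ 3 * L" by (simp add: Y_def eval_nat_numeral mult_ac)
    then show ?thesis using mono[of 7 9 3 4 1 1] by (simp add: W_def)
  qed
  have YW1: "Y \<le> W" using mono[of 3 9 1 4 1 1] by (simp add: Y_def W_def)
  have W: "a \<le> W" "b \<le> W" "1 \<le> W" using Y YW1 by auto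
  have e2: "5 \<le> exp (2 :: real)" "24 \<le> exp (4::real)" "120 \<le> exp (5::real)" "246 \<le> exp (6::real)" "6 \<le> exp (2::real)"
  proof -
    have e: "(27/10 :: real) ^ k \<le> exp (real k)" for k
    proof -
      have "(27/10 :: real) ^ k \<le> exp 1 ^ k" using e_approx_32 by (intro power_mono) (auto simp: abs_if split: if_splits)
      then show ?thesis by (simp add: exp_of_nat_mult[symmetric])
    qed
    show "5 \<le> exp (2 :: real)" "24 \<le> exp (4::real)" "120 \<le> exp (5::real)" "246 \<le> exp (6::real)" "6 \<le> exp (2::real)"
      using e[of 2] e[of 4] e[of 5] e[of 6] by (auto simp: eval_nat_numeral)
  qed
  have ea: "a \<le> exp (a - 1)" and eb: "b \<le> exp (b - 1)" by (rule le_exp_minus_one)+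
  have ea': "a \<le> exp a" and eb': "b \<le> exp b"
    using exp_ge_add_one_self[of a] exp_ge_add_one_self[of b] by linarith+
  have pa: "a ^ k \<le> exp (real k * a)" and pb: "b ^ k \<le> exp (real k * b)" for k
    using power_mono[OF ea', of k] power_mono[OF eb', of k] a1 b1 by (auto simp: exp_of_nat_mult)
  have G0: "G \<ge> 0" by (simp add: G_def)
  have GE: "G \<le> exp (4 * (a * b * L))"
  proof -
    have "G = 5 * a * real M * b ^ 2" by (simp add: G_def a_def b_def)
    also have "\<dots> \<le> exp 2 * exp (a - 1) * exp (L - 1) * (exp (b - 1)) ^ 2"
      unfolding Mexp using e2 ea eb a1 b1 by (intro mult_mono power_mono) auto
    also have "\<dots> = exp (2 + (a - 1) + (L - 1) + 2 * (b - 1))"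
      by (simp only: exp_add exp_double)
    also have "\<dots> \<le> exp (4 * (a * b * L))"
      using mono[of 1 1 0 1 0 1] mono[of 0 1 1 1 0 1] mono[of 0 1 0 1 1 1] by simp
    finally show ?thesis .
  qed
  have HE: "H \<le> exp (5 * Y)"
  proof -
    have "fact n \<le> a ^ n" using fact_le_power[of n, where 'a = real] by (simp add: a_def)
    also have "\<dots> \<le> exp (a * a)" using pa[of n] by (simp add: a_def)
    also have "\<dots> \<le> exp Y" using Y by (simp add: power2_eq_square)
    finally have f: "fact n \<le> exp Y" .
    have "G ^ (n * n) \<le> exp (4 * (a * b * L)) ^ (n * n)" using GE G0 by (rule power_mono)
    also have "\<dots> = exp (4 * Y)"
      by (simp add: exp_of_nat_mult[symmetric] a_def Y_def power3_eq_cube mult_ac)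
    finally have "H \<le> exp Y * exp (4 * Y)" unfolding H_def using f G0 by (intro mult_mono) auto
    then show ?thesis by (simp add: exp_add[symmetric])
  qed
  have H0: "H \<ge> 0" using G0 by (simp add: H_def)
  have NE: "real N \<le> 6 * (a ^ 4 * b ^ 2)"
  proof -
    have "real N = (real D + 1) * (2 * real D + 1)" by (simp add: N_def algebra_simps)
    also have "\<dots> \<le> (2 * real D) * (3 * real D)" using D1 by (intro mult_mono) auto
    finally show ?thesis by (simp add: Dr power2_eq_square eval_nat_numeral mult_ac)
  qed
  have U: "(real N * (real (3 * D + 1) * H\<^sup>2)) ^ N \<le> exp (138 * W)"
  proof -
    have "real N * (real (3 * D + 1) * H\<^sup>2) \<le> 6 * (a ^ 4 * b ^ 2) * ((4 * (a\<^sup>2 * b)) * (exp (5 * Y))\<^sup>2)"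
    proof (intro mult_mono power_mono NE HE H0)
      show "real (3 * D + 1) \<le> 4 * (a\<^sup>2 * b)" unfolding Dr[symmetric] using D1 by simp
    qed (use a1 b1 in auto)
    also have "\<dots> = 24 * a ^ 6 * b ^ 3 * exp (10 * Y)"
      by (simp add: eval_nat_numeral exp_add[symmetric])
    also have "\<dots> \<le> exp 4 * exp (6 * a) * exp (3 * b) * exp (10 * Y)"
      using e2 pa[of 6] pb[of 3] a1 b1 by (intro mult_mono) auto
    also have "\<dots> = exp (4 + 6 * a + 3 * b + 10 * Y)" by (simp only: exp_add)
    also have "\<dots> \<le> exp (23 * Y)" using Y by simp
    finally have "(real N * (real (3 * D + 1) * H\<^sup>2)) ^ N \<le> exp (23 * Y) ^ N"
      by (intro power_mono) auto
    also have "\<dots> = exp (23 * (real N * Y))" by (simp add: exp_of_nat_mult[symmetric] mult_ac)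
    also have "\<dots> \<le> exp (138 * W)"
    proof -
      have "real N * Y \<le> 6 * (a ^ 4 * b ^ 2) * Y" using NE Y by (intro mult_right_mono) auto
      then have "real N * Y \<le> 6 * W" using YW by (simp add: mult.assoc)
      then show ?thesis by (simp add: mult.commute)
    qed
    finally show ?thesis .
  qed
  define F where "F = max 1 E"
  have F1: "F \<ge> 1" by (simp add: F_def)
  have D2: "real D + 1 \<le> exp (4 * W)" "2 * real D + 1 \<le> exp (5 * W)"
  proof -
    have "a\<^sup>2 * b \<le> exp (2 * a) * exp b" using pa[of 2] eb' a1 b1 by (intro mult_mono) auto
    also have "\<dots> \<le> exp (3 * W)" using W by (simp add: exp_add[symmetric])
    finally have D3: "real D \<le> exp (3 * W)" by (simp add: Dr)
    have W2: "2 \<le> exp W" "3 \<le> exp (2 * W)" 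
      using exp_ge_add_one_self[of W] exp_ge_add_one_self[of "2 * W"] W by linarith+
    have "real D + 1 \<le> 2 * real D" using D1 by simp
    also have "\<dots> \<le> exp W * exp (3 * W)" using W2 D3 by (intro mult_mono) auto
    finally show "real D + 1 \<le> exp (4 * W)" by (simp add: exp_add[symmetric])
    have "2 * real D + 1 \<le> 3 * real D" using D1 by simp
    also have "\<dots> \<le> exp (2 * W) * exp (3 * W)" using W2 D3 by (intro mult_mono) auto
    finally show "2 * real D + 1 \<le> exp (5 * W)" by (simp add: exp_add[symmetric])
  qed
  have \<Lambda>E: "\<Lambda> \<le> exp (147 * W) * F ^ (2 * D)"
  proof -
    have "max 1 \<bar>x\<bar> \<le> F" using E(2) by (auto simp: F_def)
    then have "\<Lambda> \<le> exp (4 * W) * (exp (5 * W) * exp (138 * W) * F ^ (2 * D))"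
      unfolding \<Lambda>_def using D2 U by (intro mult_mono power_mono) auto
    then show ?thesis by (simp add: exp_add[symmetric] flip: mult.assoc)
  qed
  have \<Lambda>0: "\<Lambda> \<ge> 0" unfolding \<Lambda>_def by simp
  have P: "(60 * (real D + 1) * R\<^sup>2) ^ D \<le> exp (8 * W) * R ^ (2 * D)"
  proof -
    have "60 * (real D + 1) \<le> 120 * real D" using D1 by simp
    also have "\<dots> = 120 * a ^ 2 * b ^ 1" by (simp add: Dr)
    also have "\<dots> \<le> exp 5 * exp (2 * a) * exp b"
      using e2 pa[of 2] pb[of 1] a1 b1 by (intro mult_mono) auto
    also have "\<dots> = exp (5 + 2 * a + b)" by (simp only: exp_add)
    also have "\<dots> \<le> exp (8 * (a * b))"
      using mono[of 0 1 0 1 0 0] mono[of 1 1 0 1 0 0] mono[of 0 1 1 1 0 0] by simp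
    finally have "(60 * (real D + 1)) ^ D \<le> exp (8 * (a * b)) ^ D" by (intro power_mono) auto
    also have "\<dots> = exp (8 * (real D * (a * b)))" by (simp add: exp_of_nat_mult[symmetric] mult_ac)
    also have "\<dots> \<le> exp (8 * W)"
      using mono[of 3 9 2 4 0 1] by (simp add: Dr W_def eval_nat_numeral mult_ac)
    finally have "(60 * (real D + 1)) ^ D * (R\<^sup>2) ^ D \<le> exp (8 * W) * (R\<^sup>2) ^ D"
      using R by (intro mult_right_mono) auto
    then show ?thesis by (simp add: power_mult_distrib power_mult)
  qed
  define T where "T = exp (159 * W) * F ^ (2 * D) * R ^ (2 * D)"
  have T1: "T \<ge> 1"
  proof -
    have "1 * 1 * 1 \<le> exp (159 * W) * F ^ (2 * D) * R ^ (2 * D)"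
      using W F1 R by (intro mult_mono one_le_power) auto
    then show ?thesis by (simp add: T_def)
  qed
  have KT: "(real D + 1) * \<Lambda> * (60 * (real D + 1) * R\<^sup>2) ^ D \<le> T"
  proof -
    have "(real D + 1) * \<Lambda> * (60 * (real D + 1) * R\<^sup>2) ^ D
        \<le> exp (4 * W) * (exp (147 * W) * F ^ (2 * D)) * (exp (8 * W) * R ^ (2 * D))"
      using D2 \<Lambda>E \<Lambda>0 P R F1 by (intro mult_mono) auto
    also have "\<dots> = (exp (4 * W) * exp (147 * W) * exp (8 * W)) * F ^ (2 * D) * R ^ (2 * D)"
      by (simp only: mult_ac)
    also have "exp (4 * W) * exp (147 * W) * exp (8 * W) = exp (159 * W)"
      by (simp add: exp_add[symmetric])
    also have "\<dots> * F ^ (2 * D) * R ^ (2 * D) = T" by (simp only: T_def)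
    finally show ?thesis .
  qed
  have lnb: "ln (real n * fact n) \<le> 2 * a ^ 2"
  proof -
    have "real n * fact n \<le> a * a ^ n"
      using fact_le_power[of n, where 'a = real] by (intro mult_mono) (auto simp: a_def)
    then have "ln (real n * fact n) \<le> ln (a ^ Suc n)" using n a1 by (subst ln_le_cancel_iff) auto
    also have "\<dots> = real (Suc n) * ln a" by (rule ln_realpow)
    also have "\<dots> = (a + 1) * ln a" by (simp only: a_def of_nat_Suc add.commute)
    also have "\<dots> \<le> (2 * a) * a" using a1 ln_le_minus_one[of a] by (intro mult_mono) auto
    finally show ?thesis by (simp add: power2_eq_square)
  qed
  define q where "q = n * (n + 1) * d"
  have "3 * (40 * R * real n * (1 + (real D + 1) * \<Lambda> * (60 * (real D + 1) * R\<^sup>2) ^ D) + ln (real n * fact n))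
      \<le> 3 * (40 * R * a * (2 * T) + 2 * a ^ 2)"
    using KT T1 lnb R a1 by (intro mult_left_mono add_mono) (auto simp: a_def)
  also have "\<dots> \<le> 246 * a ^ 2 * (R * T)"
  proof -
    have RT: "1 \<le> R * T" using mult_mono[of 1 R 1 T] R T1 by simp
    have "R * a * T \<le> a ^ 2 * (R * T)"
      using mult_right_mono[of a "a\<^sup>2" "R * T"] a1 RT by (simp add: mult_ac power2_eq_square)
    moreover have "a ^ 2 \<le> a ^ 2 * (R * T)" using RT a1 by simp
    ultimately show ?thesis by simp
  qed
  also have "\<dots> \<le> exp 6 * exp (2 * a) * (R * T)"
    using e2 pa[of 2] a1 R T1 by (intro mult_mono) auto
  also have "\<dots> \<le> exp (8 * W) * (R * T)"
    using W R T1 by (intro mult_right_mono) (auto simp: exp_add[symmetric])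
  also have "\<dots> = exp (167 * W) * F ^ (2 * D) * R ^ (2 * D + 1)"
  proof -
    have "exp (167 * W) = exp (8 * W) * exp (159 * W)" by (simp add: exp_add[symmetric])
    then show ?thesis unfolding T_def by (simp add: mult_ac)
  qed
  also have "\<dots> \<le> exp (166 * W) ^ 4 * (E ^ (q) + 1) ^ 4 * (R powr (real q / 2 + 1)) ^ 4"
  proof (intro mult_mono)
    show "exp (167 * W) \<le> exp (166 * W) ^ 4" using W by (simp add: exp_of_nat_mult[symmetric])
    have kD: "D \<le> q" by (simp add: D_def q_def)
    have "F ^ (2 * D) \<le> F ^ (q * 4)" using F1 kD by (intro power_increasing) auto
    also have "\<dots> = (F ^ (q)) ^ 4" by (simp add: power_mult)
    also have "\<dots> \<le> (E ^ (q) + 1) ^ 4"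
      using E F1 by (intro power_mono) (auto simp: F_def max_def)
    finally show "F ^ (2 * D) \<le> (E ^ (q) + 1) ^ 4" .
    have "R ^ (2 * D + 1) \<le> R ^ (2 * (q) + 4)" using R kD by (intro power_increasing) auto
    also have "\<dots> = R powr real (2 * (q) + 4)" using R by (intro powr_realpow[symmetric]) auto
    also have "\<dots> = R powr ((real q / 2 + 1) * 4)"
      by (rule arg_cong[where f = "\<lambda>y. R powr y"]) simp
    also have "\<dots> = (R powr (real q / 2 + 1)) powr 4" by (rule powr_powr[symmetric])
    also have "\<dots> = (R powr (real q / 2 + 1)) ^ 4" by (rule powr_numeral) (use R in simp)
    finally show "R ^ (2 * D + 1) \<le> (R powr (real q / 2 + 1)) ^ 4" .
  qed (use F1 R E in auto)
  also have "\<dots> = (exp (166 * W) * (E ^ (q) + 1) * R powr (real q / 2 + 1)) ^ 4"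
    by (simp only: power_mult_distrib)
  also have "\<dots> \<le> (exp (166 * W) * (E ^ (q) + 1) * R powr (real q / 2 + 1) + real n) ^ 4"
    using E by (intro power_mono) auto
  also have "exp (166 * W) = (real M * exp 1) powr (166 * real n ^ 9 * real d ^ 4)"
    using M unfolding Mexp by (simp add: powr_def W_def a_def b_def mult_ac flip: exp_add)
  also have "(\<dots> * (E ^ (q) + 1) * R powr (real q / 2 + 1) + real n) ^ 4
     = (\<dots> * (E ^ (q) + 1) * R powr (real q / 2 + 1) + real n) powr 4"
    using E M n by (subst powr_numeral) (auto intro!: add_pos_pos add_nonneg_pos)
  finally show ?thesis unfolding q_def .
qed

text \<open>
  The zeros enter through an arbitrary finite subset, so that finiteness of the zero set follows from
  the bound.
\<close>

lemma card_zeros_le: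
  fixes x :: "complex \<Rightarrow> complex Matrix.vec" and n d M :: nat
  assumes n: "n \<ge> 1" and d: "d \<ge> 1" and M: "M \<ge> 1" and A: "A \<in> carrier_mat n n"
    and bd: "\<forall>i<n. \<forall>j<n. total_degree (A $$ (i, j)) \<le> d \<and> height_le (A $$ (i, j)) M"
    and R: "R \<ge> 2" and sol: "holomorphic_solution n A (complex_of_real \<epsilon>) x"
    and nz: "x w $ 0 \<noteq> 0"
    and Z: "finite Z" "Z \<subseteq> {s \<in> {-R/2..R/2}. x (complex_of_real s) $ 0 = 0}"
  defines "G \<equiv> 5 * real n * real M * (real d)\<^sup>2"
  defines "D \<equiv> n * n * d" and "H \<equiv> fact n * G ^ (n * n)"
  defines "N \<equiv> (D + 1) * (2 * D + 1)"
  defines "\<Lambda> \<equiv> real (D + 1) * (real (2 * D + 1) * (real N * (real (3 * D + 1) * H\<^sup>2)) ^ N * (max 1 \<bar>\<epsilon>\<bar>) ^ (2 * D))"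
  shows "real (card Z) \<le> 3 * (40 * R * real n * (1 + (real D + 1) * \<Lambda> * (60 * (real D + 1) * R\<^sup>2) ^ D) + ln (real n * fact n))"
proof -
  let ?A = "real_system n A"
  let ?f = "\<lambda>t. x t $ 0"
  have d1: "real d \<ge> 1" and M1: "real M \<ge> 1" and n1: "real n \<ge> 1" using d M n by auto
  have G: "real n * (real d + real M * (real d + 1)\<^sup>2) \<le> G"
  proof -
    have "real d \<le> real M * (real d)\<^sup>2"
      using mult_mono[of 1 "real M" "real d" "(real d)\<^sup>2"] d1 M1 by (simp add: power2_eq_square)
    moreover have "(real d + 1)\<^sup>2 \<le> (2 * real d)\<^sup>2" using d1 by (intro power_mono) auto
    then have "real M * (real d + 1)\<^sup>2 \<le> real M * (4 * (real d)\<^sup>2)"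
      by (intro mult_left_mono) (auto simp: power_mult_distrib)
    ultimately have "real n * (real d + real M * (real d + 1)\<^sup>2) \<le> real n * (5 * (real M * (real d)\<^sup>2))"
      by (intro mult_left_mono) auto
    then show ?thesis by (simp add: G_def mult_ac)
  qed
  have G1: "1 \<le> G"
  proof -
    have "1 * (0 + 1 * (0 + 1)\<^sup>2) \<le> real n * (real d + real M * (real d + 1)\<^sup>2)"
      using d1 M1 n1 by (intro mult_mono add_mono power_mono) auto
    then show ?thesis using G by simp
  qed
  have out: "\<forall>p. \<forall>q\<ge>n. ?A p q = 0" by (simp add: real_system_def)
  note U = uniform_scalar_equation[of d "real M * (real d + 1)\<^sup>2" ?A n G, OF real_system_bipoly_le[OF bd] out G G1 n,
      folded D_def H_def, folded N_def]
  from U obtain r \<delta> m where r: "1 \<le> r" "r \<le> n" and deg: "degree \<delta> \<le> D" "\<forall>j<r. degree (m j) \<le> D"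
    and rel: "\<forall>q. \<delta> * jet_row n ?A r q = (\<Sum>j<r. m j * jet_row n ?A j q)"
    and all: "\<forall>y. (\<exists>k. poly (coeff \<delta> k) y \<noteq> 0) \<and> (\<forall>j<r. \<forall>k. \<exists>i. \<bar>poly (coeff (m j) k) y\<bar>
      \<le> real (D + 1) * (real (2 * D + 1) * (real N * (real (3 * D + 1) * H\<^sup>2)) ^ N * (max 1 \<bar>y\<bar>) ^ (2 * D))
        * \<bar>poly (coeff \<delta> i) y\<bar>)"
    by (elim exE conjE)
  have \<delta>nz: "\<exists>k. poly (coeff \<delta> k) \<epsilon> \<noteq> 0" using all by blast
  have bnd: "\<exists>i. \<bar>poly (coeff (m j) k) \<epsilon>\<bar> \<le> \<Lambda> * \<bar>poly (coeff \<delta> i) \<epsilon>\<bar>" if "j < r" for j k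
    using all[rule_format, of \<epsilon>] that unfolding \<Lambda>_def by blast
  have \<Lambda>0: "\<Lambda> \<ge> 0" unfolding \<Lambda>_def by simp
  have hd: "((deriv ^^ k) ?f) t = (\<Sum>q<n. poly (specialize \<epsilon> (jet_row n ?A k q)) t * x t $ q)" for k t
    by (rule solution_higher_deriv[OF sol A n])
  have "real (card (complex_of_real ` Z)) \<le> 3 * (40 * R * real r * (1 + (real D + 1) * \<Lambda> * (60 * (real D + 1) * R\<^sup>2) ^ D)
            + ln (real r * fact r))"
  proof (rule zero_count_linear_ode[where q = "specialize \<epsilon> \<delta>" and p = "\<lambda>j. specialize \<epsilon> (m j)" and f = ?f])
    show "?f holomorphic_on UNIV"
      unfolding holomorphic_on_def field_differentiable_def
      using sol n by (auto simp: holomorphic_solution_def)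
    show "x w $ 0 \<noteq> 0" by (rule nz)
    show "specialize \<epsilon> \<delta> \<noteq> 0"
      using \<delta>nz by (metis coeff_0 coeff_specialize of_real_eq_0_iff)
    show "degree (specialize \<epsilon> \<delta>) \<le> D" "\<And>j. j < r \<Longrightarrow> degree (specialize \<epsilon> (m j)) \<le> D"
      using deg by (auto intro: order_trans[OF degree_specialize_le])
    fix t
    have "poly (specialize \<epsilon> \<delta>) t * (deriv ^^ r) ?f t
        = (\<Sum>q<n. poly (specialize \<epsilon> (\<delta> * jet_row n ?A r q)) t * x t $ q)"
      unfolding hd by (simp add: specialize_mult sum_distrib_left mult_ac)
    also have "\<dots> = (\<Sum>q<n. \<Sum>j<r. poly (specialize \<epsilon> (m j)) t * (poly (specialize \<epsilon> (jet_row n ?A j q)) t * x t $ q))"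
      unfolding rel[rule_format] by (simp add: specialize_sum specialize_mult poly_sum sum_distrib_right mult.assoc)
    also have "\<dots> = (\<Sum>j<r. \<Sum>q<n. poly (specialize \<epsilon> (m j)) t * (poly (specialize \<epsilon> (jet_row n ?A j q)) t * x t $ q))"
      by (rule sum.swap)
    finally show "poly (specialize \<epsilon> \<delta>) t * (deriv ^^ r) ?f t = (\<Sum>j<r. poly (specialize \<epsilon> (m j)) t * (deriv ^^ j) ?f t)"
      unfolding hd by (simp add: sum_distrib_left)
  next
    fix j k assume "j < r"
    then show "\<exists>i. cmod (coeff (specialize \<epsilon> (m j)) k) \<le> \<Lambda> * cmod (coeff (specialize \<epsilon> \<delta>) i)"
      using bnd[of j k] by (simp add: coeff_specialize)
  qed (use Z r R \<Lambda>0 in auto)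
  also have "\<dots> \<le> 3 * (40 * R * real n * (1 + (real D + 1) * \<Lambda> * (60 * (real D + 1) * R\<^sup>2) ^ D) + ln (real n * fact n))"
  proof (intro mult_left_mono add_mono mult_right_mono)
    have "real r * fact r \<le> real n * fact n" using r by (intro mult_mono fact_mono) auto
    then show "ln (real r * fact r) \<le> ln (real n * fact n)" using r by (subst ln_le_cancel_iff) auto
  qed (use r R \<Lambda>0 in auto)
  also have "card (complex_of_real ` Z) = card Z" by (rule card_image) (simp add: inj_on_def)
  finally show ?thesis .
qed

theorem theorem2:
  shows "\<exists>C>0::real. \<exists>\<sigma>>0::real.
    \<forall>(n::nat) (d::nat) (M::nat) (A :: int poly poly mat) (R::real) (E::real) (\<epsilon>::real)
      (x :: complex \<Rightarrow> complex Matrix.vec).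
      n \<ge> 1 \<longrightarrow> d \<ge> 1 \<longrightarrow> M \<ge> 1 \<longrightarrow>
      A \<in> carrier_mat n n \<longrightarrow>
      (\<forall>i<n. \<forall>j<n. total_degree (A $$ (i, j)) \<le> d \<and> height_le (A $$ (i, j)) M) \<longrightarrow>
      {-1..1} \<subseteq> {-R/2..R/2} \<longrightarrow>
      E > 0 \<longrightarrow> \<bar>\<epsilon>\<bar> < E \<longrightarrow>
      holomorphic_solution n A (complex_of_real \<epsilon>) x \<longrightarrow>
      (\<forall>s::real. x (complex_of_real s) $ 0 \<in> \<real>) \<longrightarrow>
      (\<exists>t. x t $ 0 \<noteq> 0) \<longrightarrow>
      finite {s \<in> {-R/2..R/2}. x (complex_of_real s) $ 0 = 0} \<and>
      real (card {s \<in> {-R/2..R/2}. x (complex_of_real s) $ 0 = 0}) \<le>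
        ((real M * exp 1) powr (C * real n ^ 9 * real d ^ 4)
           * (E ^ (n * (n + 1) * d) + 1)
           * R powr (real (n * (n + 1) * d) / 2 + 1)
         + real n) powr \<sigma>"
proof (rule exI[of _ 166], rule conjI, simp, rule exI[of _ 4], rule conjI, simp, intro allI impI)
  fix n d M :: nat and A :: "int poly poly mat" and R E \<epsilon> :: real
    and x :: "complex \<Rightarrow> complex Matrix.vec"
  assume h: "n \<ge> 1" "d \<ge> 1" "M \<ge> 1" "A \<in> carrier_mat n n"
    "\<forall>i<n. \<forall>j<n. total_degree (A $$ (i, j)) \<le> d \<and> height_le (A $$ (i, j)) M"
    and seg: "{-1..1} \<subseteq> {-R/2..R/2}" and E: "E > 0" "\<bar>\<epsilon>\<bar> < E"
    and sol: "holomorphic_solution n A (complex_of_real \<epsilon>) x" and nz: "\<exists>t. x t $ 0 \<noteq> 0"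
  have "1 \<in> {-R/2..R/2}" using seg by auto
  then have R: "R \<ge> 2" by auto
  obtain w where w: "x w $ 0 \<noteq> 0" using nz by blast
  let ?S = "{s \<in> {-R/2..R/2}. x (complex_of_real s) $ 0 = 0}"
  let ?B = "((real M * exp 1) powr (166 * real n ^ 9 * real d ^ 4) * (E ^ (n * (n + 1) * d) + 1)
           * R powr (real (n * (n + 1) * d) / 2 + 1) + real n) powr 4"
  have bound: "real (card Z) \<le> ?B" if "finite Z" "Z \<subseteq> ?S" for Z
    using card_zeros_le[OF h R sol w that] explicit_bound_le[OF h(1-3) R E(1) less_imp_le[OF E(2)]]
    by (rule order_trans)
  have "finite ?S"
  proof (rule ccontr)
    assume "infinite ?S"
    then obtain Z where "Z \<subseteq> ?S" "finite Z" "card Z = nat \<lceil>?B\<rceil> + 1"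
      using infinite_arbitrarily_large by blast
    then show False using bound[of Z] by linarith
  qed
  then show "finite ?S \<and> real (card ?S) \<le> ?B" using bound by blast
qed

end
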